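(* There exists a smooth generic immersion $j\colon T\looparrowright Y$ from a compact surface $T$ to a compact 3-manifold $Y$ that satisfies the conditions $\mu_2(j)=\nu_3(j)=0$, but does not lift to an embedding, i.e. there is no embedding $\widetilde{j}\colon T\to Y\times\mathbb{R}$ with $j=\mathrm{pr}_Y\circ\widetilde{j}$.
   Context: An immersion $f\colon X\looparrowright Y$ of smooth manifolds (possibly with boundary) is generic if: (1) $f^{-1}(\partial Y)=\partial X$; (2) for $y\in Y\setminus\partial Y$ with $f^{-1}(y)=\{x_i\}_{i=1}^n$, the subspaces $df_{x_i}(T_{x_i}X)$ are in general position in $T_yY$, that is, $\operatorname{codim}\bigcap_{i=1}^n df_{x_i}(T_{x_i}X)=\sum_{i=1}^n\operatorname{codim}df_{x_i}(T_{x_i}X)$; (3) for $y\in\partial Y$ with $f^{-1}(y)=\{x_i\}_{i=1}^n$, the subspaces $T_y\partial Y$ and $df_{x_i}(T_{x_i}X)$, $i=1,\dots,n$, are in general position in $T_yY$. For a generic immersion $f\colon X\looparrowright Y$, let $\mathrm{Conf}_f(X,n)$ be the space of ordered $n$-tuples of distinct points of $X$ with the same image under $f$, and $\widetilde{\mathrm{Conf}}_f(X,n)=\mathrm{Conf}_f(X,n)/S_n$ its unordered version. The condition $\mu_2(f)=0$ means that the double covering $P_2\colon\mathrm{Conf}_f(X,2)\to\widetilde{\mathrm{Conf}}_f(X,2)$ is trivial. The condition $\nu_3(f)=0$ is defined as follows. Let $S_{2,3}\subseteq\mathrm{Conf}_f(X,2)\times\widetilde{\mathrm{Conf}}_f(X,3)$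 be the set of points $(a,b)\times\{c,d,e\}$ with $\{a,b\}\subset\{c,d,e\}$. Let $\mathbb{T}$ be the collection of all equivalence relations $\sim$ on $S_{2,3}$ such that (with $T_1,T_2$ denoting unordered triples and all written points lying in $S_{2,3}$): (i) if $(a,b)\times T_1\sim(c,d)\times T_2$, then $(b,a)\times T_1\sim(d,c)\times T_2$; (ii) if $(a,b)$ and $(c,d)$ lie in the same connected component of $\mathrm{Conf}_f(X,2)$, then $(a,b)\times T_1\sim(c,d)\times T_2$; (iii) whenever $(a,b)\times\{a,b,c\}\sim(b,c)\times\{a,b,c\}$, also $(a,b)\times\{a,b,c\}\sim(b,c)\times\{a,b,c\}\sim(a,c)\times\{a,b,c\}$. The collection $\mathbb{T}$ is closed under intersections; let $\sim_\nu$ be its smallest (finest) element. Then $\nu_3(f)=0$ means that there are no points $a,b,c$ such that $(a,b)\times\{a,b,c\}\sim_\nu(b,c)\times\{a,b,c\}\sim_\nu(c,a)\times\{a,b,c\}$. *)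

theory Defs
  imports "HOL-Analysis.Analysis"
begin

section \<open>Smooth maps between subsets of Euclidean spaces\<close>

primrec k_times_differentiable_on ::
  "nat \<Rightarrow> ('v::euclidean_space \<Rightarrow> 'w::euclidean_space) \<Rightarrow> 'v set \<Rightarrow> bool" where
  "k_times_differentiable_on 0 g W \<longleftrightarrow> continuous_on W g"
| "k_times_differentiable_on (Suc k) g W \<longleftrightarrow>
     (\<forall>p\<in>W. g differentiable (at p)) \<and>
     (\<forall>v. k_times_differentiable_on k (\<lambda>p. frechet_derivative g (at p) v) W)"

text \<open>On a set that is not open (such as a relatively open subset of a half-space), smoothness
  means the existence of local smooth extensions.\<close>

definition smooth_on :: "'v set \<Rightarrow> ('v::euclidean_space \<Rightarrow> 'w::euclidean_space) \<Rightarrow> bool" where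
  "smooth_on S F \<longleftrightarrow>
     (\<forall>p\<in>S. \<exists>W g. open W \<and> p \<in> W \<and> (\<forall>k. k_times_differentiable_on k g W) \<and>
                   (\<forall>q\<in>S \<inter> W. g q = F q))"

section \<open>Smooth manifolds with boundary\<close>

definition half_space :: "(real^'n::{finite,one}) set" where
  "half_space = {v. 0 \<le> v $ 1}"

text \<open>A chart is a pair \<open>(U, \<phi>)\<close> of a domain and a map; only the values of \<open>\<phi>\<close> on \<open>U\<close> matter.
  The dimension of a manifold is the cardinality of the index type \<open>'n\<close>. The topology of a
  manifold is an arbitrary one on an arbitrary subset of \<open>'a\<close>, unrelated to any topology of the
  type \<open>'a\<close>. A second countable manifold has at most continuum many points, so it is no loss of
  generality to take for \<open>'a\<close> a type of that cardinality, such as \<open>nat \<times> (real^2)\<close>.\<close>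

type_synonym ('a, 'n) chart = "'a set \<times> ('a \<Rightarrow> real^'n)"

record ('a, 'n) manifold =
  space_of :: "'a topology"
  atlas :: "('a, 'n) chart set"

abbreviation pts :: "('a, 'n::finite) manifold \<Rightarrow> 'a set" where
  "pts M \<equiv> topspace (space_of M)"

definition chart_inv :: "('a, 'n::finite) chart \<Rightarrow> real^'n \<Rightarrow> 'a" where
  "chart_inv c = inv_into (fst c) (snd c)"

definition is_chart :: "'a topology \<Rightarrow> ('a, 'n::{finite,one}) chart \<Rightarrow> bool" where
  "is_chart X c \<longleftrightarrow>
     openin X (fst c) \<and>
     openin (top_of_set half_space) (snd c ` fst c) \<and>
     homeomorphic_map (subtopology X (fst c)) (top_of_set (snd c ` fst c)) (snd c)"

text \<open>The atlas need not be maximal.\<close>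

definition smooth_manifold :: "('a, 'n::{finite,one}) manifold \<Rightarrow> bool" where
  "smooth_manifold M \<longleftrightarrow>
     Hausdorff_space (space_of M) \<and> second_countable (space_of M) \<and>
     (\<forall>c\<in>atlas M. is_chart (space_of M) c) \<and>
     pts M = (\<Union>c\<in>atlas M. fst c) \<and>
     (\<forall>c\<in>atlas M. \<forall>d\<in>atlas M.
        smooth_on (snd c ` (fst c \<inter> fst d)) (snd d \<circ> chart_inv c))"

definition charts_at :: "('a, 'n::finite) manifold \<Rightarrow> 'a \<Rightarrow> ('a, 'n) chart set" where
  "charts_at M x = {c \<in> atlas M. x \<in> fst c}"

definition boundary :: "('a, 'n::{finite,one}) manifold \<Rightarrow> 'a set" where
  "boundary M = {x \<in> pts M. \<exists>c\<in>charts_at M x. snd c x $ 1 = 0}"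

section \<open>Generic immersions\<close>

definition local_rep ::
  "('a \<Rightarrow> 'b) \<Rightarrow> ('a, 'm::finite) chart \<Rightarrow> ('b, 'n::finite) chart \<Rightarrow> real^'m \<Rightarrow> real^'n" where
  "local_rep f c d = snd d \<circ> f \<circ> chart_inv c"

definition smooth_map ::
  "('a, 'm::finite) manifold \<Rightarrow> ('b, 'n::finite) manifold \<Rightarrow> ('a \<Rightarrow> 'b) \<Rightarrow> bool" where
  "smooth_map M N f \<longleftrightarrow>
     continuous_map (space_of M) (space_of N) f \<and>
     (\<forall>c\<in>atlas M. \<forall>d\<in>atlas N.
        smooth_on (snd c ` {x \<in> fst c. f x \<in> fst d}) (local_rep f c d))"

text \<open>The differential \<open>df\<^sub>x\<close> read in a chart \<open>c\<close> at \<open>x\<close> and a chart \<open>d\<close> at \<open>f x\<close>; these charts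
  identify the tangent spaces with Euclidean spaces. The derivative within \<open>snd c ` fst c\<close> is
  unique also at boundary points, since a half-space contains, at each of its points, a segment
  in every coordinate direction up to sign.\<close>

definition differential_in ::
  "('a \<Rightarrow> 'b) \<Rightarrow> ('a, 'm::finite) chart \<Rightarrow> ('b, 'n::finite) chart \<Rightarrow> 'a \<Rightarrow> real^'m \<Rightarrow> real^'n" where
  "differential_in f c d x =
     frechet_derivative (local_rep f c d) (at (snd c x) within snd c ` fst c)"

definition immersion ::
  "('a, 'm::finite) manifold \<Rightarrow> ('b, 'n::finite) manifold \<Rightarrow> ('a \<Rightarrow> 'b) \<Rightarrow> bool" where
  "immersion M N f \<longleftrightarrow>
     smooth_map M N f \<and>
     (\<forall>x\<in>pts M. \<forall>c\<in>charts_at M x. \<forall>d\<in>charts_at N (f x). inj (differential_in f c d x))"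

definition codim :: "'v::euclidean_space set \<Rightarrow> nat" where
  "codim V = DIM('v) - dim V"

definition general_position :: "'i set \<Rightarrow> ('i \<Rightarrow> 'v::euclidean_space set) \<Rightarrow> bool" where
  "general_position I V \<longleftrightarrow> finite I \<and> codim (\<Inter>i\<in>I. V i) = (\<Sum>i\<in>I. codim (V i))"

definition fibre :: "('a, 'm::finite) manifold \<Rightarrow> ('a \<Rightarrow> 'b) \<Rightarrow> 'b \<Rightarrow> 'a set" where
  "fibre M f y = {x \<in> pts M. f x = y}"

text \<open>In a chart at a boundary point, the tangent space of the boundary is the hyperplane
  \<open>v $ 1 = 0\<close>; it is the member with index \<open>None\<close> of the family in the last clause.
  The function \<open>c\<close> chooses a chart at each point of the fibre.\<close>

definition generic_immersion ::
  "('a, 'm::{finite,one}) manifold \<Rightarrow> ('b, 'n::{finite,one}) manifold \<Rightarrow> ('a \<Rightarrow> 'b) \<Rightarrow> bool" where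
  "generic_immersion M N f \<longleftrightarrow>
     immersion M N f \<and>
     {x \<in> pts M. f x \<in> boundary N} = boundary M \<and>
     (\<forall>y \<in> pts N - boundary N. \<forall>d\<in>charts_at N y. \<forall>c.
        (\<forall>x\<in>fibre M f y. c x \<in> charts_at M x) \<longrightarrow>
        general_position (fibre M f y) (\<lambda>x. range (differential_in f (c x) d x))) \<and>
     (\<forall>y \<in> boundary N. \<forall>d\<in>charts_at N y. \<forall>c.
        (\<forall>x\<in>fibre M f y. c x \<in> charts_at M x) \<longrightarrow>
        general_position (insert None (Some ` fibre M f y))
          (case_option {v. v $ 1 = 0} (\<lambda>x. range (differential_in f (c x) d x))))"

section \<open>Configuration spaces of multiple points\<close>

definition quotient_topology :: "'a topology \<Rightarrow> ('a \<Rightarrow> 'b) \<Rightarrow> 'b topology" where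
  "quotient_topology X p =
     topology (\<lambda>U. U \<subseteq> p ` topspace X \<and> openin X {x \<in> topspace X. p x \<in> U})"

lemma openin_quotient_topology:
  "openin (quotient_topology X p) U \<longleftrightarrow>
     U \<subseteq> p ` topspace X \<and> openin X {x \<in> topspace X. p x \<in> U}"
proof -
  let ?L = "\<lambda>U. U \<subseteq> p ` topspace X \<and> openin X {x \<in> topspace X. p x \<in> U}"
  have "istopology ?L"
    unfolding istopology_def
  proof (intro conjI allI impI)
    fix S T assume "?L S" "?L T"
    moreover have "{x \<in> topspace X. p x \<in> S \<inter> T} =
      {x \<in> topspace X. p x \<in> S} \<inter> {x \<in> topspace X. p x \<in> T}" by auto
    ultimately show "S \<inter> T \<subseteq> p ` topspace X" "openin X {x \<in> topspace X. p x \<in> S \<inter> T}"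
      by auto
  next
    fix K assume "\<forall>S\<in>K. ?L S"
    moreover have "{x \<in> topspace X. p x \<in> \<Union>K} = (\<Union>S\<in>K. {x \<in> topspace X. p x \<in> S})" by auto
    ultimately show "\<Union>K \<subseteq> p ` topspace X" "openin X {x \<in> topspace X. p x \<in> \<Union>K}"
      by auto
  qed
  then show ?thesis
    by (simp add: quotient_topology_def)
qed

lemma topspace_quotient_topology [simp]:
  "topspace (quotient_topology X p) = p ` topspace X"
proof -
  have "{x \<in> topspace X. p x \<in> p ` topspace X} = topspace X" by auto
  then have "openin (quotient_topology X p) (p ` topspace X)"
    by (simp add: openin_quotient_topology)
  then show ?thesis
    by (metis openin_quotient_topology openin_subset openin_topspace subset_antisym)
qed

lemma quotient_map_quotient_topology: "quotient_map X (quotient_topology X p) p"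
  by (auto simp: quotient_map_def openin_quotient_topology)

definition conf2_top :: "'a topology \<Rightarrow> ('a \<Rightarrow> 'b) \<Rightarrow> ('a \<times> 'a) topology" where
  "conf2_top X f = subtopology (prod_topology X X) {(a, b). a \<noteq> b \<and> f a = f b}"

text \<open>The orbit of an \<open>n\<close>-tuple of distinct points under the symmetric group is represented by
  the set of its \<open>n\<close> entries. Only the topology of the double point spaces is needed.\<close>

definition unordered :: "'a \<times> 'a \<Rightarrow> 'a set" where
  "unordered p = {fst p, snd p}"

definition uconf2_top :: "'a topology \<Rightarrow> ('a \<Rightarrow> 'b) \<Rightarrow> 'a set topology" where
  "uconf2_top X f = quotient_topology (conf2_top X f) unordered"

definition uconf3 :: "'a topology \<Rightarrow> ('a \<Rightarrow> 'b) \<Rightarrow> 'a set set" where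
  "uconf3 X f = {T. T \<subseteq> topspace X \<and> card T = 3 \<and> (\<forall>a\<in>T. \<forall>b\<in>T. f a = f b)}"

section \<open>The two conditions\<close>

definition trivial_double_covering ::
  "'e topology \<Rightarrow> 'b topology \<Rightarrow> ('e \<Rightarrow> 'b) \<Rightarrow> bool" where
  "trivial_double_covering E B p \<longleftrightarrow>
     (\<exists>h. homeomorphic_map E (prod_topology B (discrete_topology (UNIV :: bool set))) h \<and>
          (\<forall>e\<in>topspace E. fst (h e) = p e))"

definition mu2_vanishes :: "'a topology \<Rightarrow> ('a \<Rightarrow> 'b) \<Rightarrow> bool" where
  "mu2_vanishes X f \<longleftrightarrow> trivial_double_covering (conf2_top X f) (uconf2_top X f) unordered"

definition S23 :: "'a topology \<Rightarrow> ('a \<Rightarrow> 'b) \<Rightarrow> (('a \<times> 'a) \<times> 'a set) set" where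
  "S23 X f = {((a, b), T). (a, b) \<in> topspace (conf2_top X f) \<and> T \<in> uconf3 X f \<and> {a, b} \<subseteq> T}"

definition nu_relations ::
  "'a topology \<Rightarrow> ('a \<Rightarrow> 'b) \<Rightarrow> ((('a \<times> 'a) \<times> 'a set) \<times> (('a \<times> 'a) \<times> 'a set)) set set" where
  "nu_relations X f = {R. equiv (S23 X f) R \<and>
     (\<forall>a b c d T1 T2. (((a, b), T1), ((c, d), T2)) \<in> R \<longrightarrow> (((b, a), T1), ((d, c), T2)) \<in> R) \<and>
     (\<forall>a b c d T1 T2. ((a, b), T1) \<in> S23 X f \<and> ((c, d), T2) \<in> S23 X f \<and>
        connected_component_of (conf2_top X f) (a, b) (c, d) \<longrightarrow>
        (((a, b), T1), ((c, d), T2)) \<in> R) \<and>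
     (\<forall>a b c. (((a, b), {a, b, c}), ((b, c), {a, b, c})) \<in> R \<longrightarrow>
        (((b, c), {a, b, c}), ((a, c), {a, b, c})) \<in> R)}"

definition nu_rel ::
  "'a topology \<Rightarrow> ('a \<Rightarrow> 'b) \<Rightarrow> ((('a \<times> 'a) \<times> 'a set) \<times> (('a \<times> 'a) \<times> 'a set)) set" where
  "nu_rel X f = \<Inter>(nu_relations X f)"

lemma total_in_nu_relations: "S23 X f \<times> S23 X f \<in> nu_relations X f"
proof -
  have "equiv (S23 X f) (S23 X f \<times> S23 X f)"
    by (auto simp: equiv_def refl_on_def sym_def trans_def)
  moreover have "((b, a), T) \<in> S23 X f" if "((a, b), T) \<in> S23 X f" for a b T
    using that by (auto simp: S23_def conf2_top_def)
  moreover have "((a, c), {a, b, c}) \<in> S23 X f"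
    if "((a, b), {a, b, c}) \<in> S23 X f" "((b, c), {a, b, c}) \<in> S23 X f" for a b c
  proof -
    have "a \<noteq> c"
    proof
      assume "a = c"
      then have "card {a, b, c} \<le> 2" by (simp add: card_insert_if)
      with that show False by (auto simp: S23_def uconf3_def)
    qed
    with that show ?thesis by (auto simp: S23_def conf2_top_def)
  qed
  ultimately show ?thesis
    unfolding nu_relations_def by blast
qed

lemma nu_rel_least:
  "nu_rel X f \<in> nu_relations X f" "R \<in> nu_relations X f \<Longrightarrow> nu_rel X f \<subseteq> R"
proof -
  have *: "equiv (S23 X f) R" if "R \<in> nu_relations X f" for R
    using that by (simp add: nu_relations_def)
  have "equiv (S23 X f) (nu_rel X f)"
  proof (rule equivI)
    show "nu_rel X f \<subseteq> S23 X f \<times> S23 X f"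
      using total_in_nu_relations by (auto simp: nu_rel_def)
    show "refl_on (S23 X f) (nu_rel X f)"
      using * by (auto simp: nu_rel_def equiv_def refl_on_def)
    show "sym (nu_rel X f)"
      using * by (auto simp: nu_rel_def equiv_def sym_def)
    show "trans (nu_rel X f)"
      using * unfolding nu_rel_def equiv_def trans_def by blast
  qed
  then show "nu_rel X f \<in> nu_relations X f"
    unfolding nu_rel_def nu_relations_def by simp
  show "R \<in> nu_relations X f \<Longrightarrow> nu_rel X f \<subseteq> R"
    by (auto simp: nu_rel_def)
qed

definition nu3_vanishes :: "'a topology \<Rightarrow> ('a \<Rightarrow> 'b) \<Rightarrow> bool" where
  "nu3_vanishes X f \<longleftrightarrow>
     \<not> (\<exists>a b c. (((a, b), {a, b, c}), ((b, c), {a, b, c})) \<in> nu_rel X f \<and>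
                 (((b, c), {a, b, c}), ((c, a), {a, b, c})) \<in> nu_rel X f)"

text \<open>Embeddings are topological here. When \<open>X\<close> is compact and \<open>f\<close> is an immersion, a topological
  lift yields a smooth one: the double points form a compact set on which the height difference
  is bounded away from zero, so the height function may be replaced by a smooth approximation,
  and a smooth lift of an immersion is an immersion.\<close>

definition lifts_to_embedding :: "'a topology \<Rightarrow> 'b topology \<Rightarrow> ('a \<Rightarrow> 'b) \<Rightarrow> bool" where
  "lifts_to_embedding X Y f \<longleftrightarrow>
     (\<exists>F. embedding_map X (prod_topology Y euclideanreal) F \<and> (\<forall>x\<in>topspace X. fst (F x) = f x))"

end

theory Submission
  imports Defs
begin

text \<open>Choosing the order of the two sheets along every double curve amounts to a
  truth assignment, and a triple point forbids exactly the two cyclic orders of its three sheets.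
  A lift therefore fails to exist if these constraints are unsatisfiable, while \<open>\<nu>\<^sub>3\<close> only
  propagates orders between sheets that share a component of the double point space. In the example
  every triple point involves three different components, so that nothing is propagated.

  The target is the Hantzsche--Wendt flat 3-manifold, whose holonomy group is the Klein four-group,
  and the surface is the flat torus covered by the plane \<open>x + y + z = 1/4\<close>. The translates
  of this plane under the group have the four normals of a tetrahedron, and the double lines form three
  components up to the swap of the sheets, one for each nontrivial holonomy. With orders \<open>p, q, r\<close>
  on them, the triple points require that none of the triples \<open>(p, q, r)\<close>, \<open>(p, \<not>q, \<not>r)\<close>,
  \<open>(\<not>p, q, \<not>r)\<close>, \<open>(\<not>p, \<not>q, r)\<close> is constant up to fixed signs; this excludes all
  eight assignments.\<close>

section \<open>Flat manifolds\<close>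

definition affine_map :: "('v::real_vector \<Rightarrow> 'w::real_vector) \<Rightarrow> bool" where
  "affine_map g \<longleftrightarrow> (\<exists>l c. linear l \<and> g = (\<lambda>x. l x + c))"

lemma affine_mapI: "linear l \<Longrightarrow> (\<And>x. g x = l x + c) \<Longrightarrow> affine_map g"
  unfolding affine_map_def by (metis ext)

lemma affine_map_comp:
  assumes "affine_map g" "affine_map h"
  shows "affine_map (\<lambda>x. g (h x))"
proof -
  obtain l c m d where "linear l" "g = (\<lambda>x. l x + c)" "linear m" "h = (\<lambda>x. m x + d)"
    using assms by (auto simp: affine_map_def)
  then show ?thesis
    using linear_compose[of m l]
    by (intro affine_mapI[of "l \<circ> m" _ "l d + c"]) (auto simp: linear_add)
qed

lemma affine_map_translation: "affine_map (\<lambda>x. x + c)"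
  by (rule affine_mapI[OF linear_id, of _ c]) simp

lemma affine_map_add_right: "affine_map g \<Longrightarrow> affine_map (\<lambda>x. g x + c)"
  using affine_map_comp[OF affine_map_translation] by blast

lemma affine_map_diff_left: "affine_map g \<Longrightarrow> affine_map (\<lambda>x. g (x - c))"
  using affine_map_comp[OF _ affine_map_translation[of "- c"]] by simp

lemma affine_map_has_derivative:
  fixes g :: "'v::euclidean_space \<Rightarrow> 'w::euclidean_space"
  assumes "affine_map g"
  shows "(g has_derivative (\<lambda>u. g u - g 0)) F"
proof -
  obtain l c where g: "linear l" "g = (\<lambda>x. l x + c)"
    using assms by (auto simp: affine_map_def)
  have "((\<lambda>x. l x + c) has_derivative (\<lambda>u. l u + 0)) F"
    using g(1) by (intro derivative_intros linear_imp_has_derivative)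
  then show ?thesis
    using g by (simp add: linear_0)
qed

lemma affine_map_continuous:
  fixes g :: "'v::euclidean_space \<Rightarrow> 'w::euclidean_space"
  assumes "affine_map g"
  shows "continuous_on S g"
  using affine_map_has_derivative[OF assms] 
  by (intro has_derivative_continuous_on) blast

text \<open>A directional derivative of an affine map is constant in the base point, hence again
  affine, so the induction closes.\<close>

lemma k_times_differentiable_on_affine:
  "affine_map g \<Longrightarrow> k_times_differentiable_on k g W"
proof (induction k arbitrary: g)
  case 0
  then show ?case by (simp add: affine_map_continuous)
next
  case (Suc k)
  have "affine_map (\<lambda>p. frechet_derivative g (at p) v)" for v
  proof -
    have "frechet_derivative g (at p) = (\<lambda>u. g u - g 0)" for p
      using affine_map_has_derivative[OF Suc.prems] frechet_derivative_at by metis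
    then show ?thesis
      by (auto intro!: affine_mapI[OF linear_zero])
  qed
  then show ?case
    using Suc affine_map_has_derivative[OF Suc.prems] by (auto simp: differentiable_def)
qed

lemma smooth_on_locally_affine:
  assumes "\<And>z. z \<in> S \<Longrightarrow> \<exists>W g. open W \<and> z \<in> W \<and> affine_map g \<and> (\<forall>q\<in>S \<inter> W. g q = F q)"
  shows "smooth_on S F"
  unfolding smooth_on_def using assms k_times_differentiable_on_affine by metis

text \<open>\<open>displacement\<close> packs freeness and proper discontinuity into one uniform
  bound: distinct points of an orbit are at least 1 apart. This is why charts can live on balls of
  radius 1/4.\<close>

locale free_crystallographic =
  fixes G :: "(real^'n::{finite,one} \<Rightarrow> real^'n::{finite,one}) set"
  assumes id_mem: "(\<lambda>v. v) \<in> G"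
    and comp_mem: "g \<in> G \<Longrightarrow> h \<in> G \<Longrightarrow> (\<lambda>v. g (h v)) \<in> G"
    and inverse_mem: "g \<in> G \<Longrightarrow> \<exists>h\<in>G. \<forall>v. h (g v) = v"
    and affine: "g \<in> G \<Longrightarrow> affine_map g"
    and isometry: "g \<in> G \<Longrightarrow> dist (g v) (g w) = dist v w"
    and displacement: "g \<in> G \<Longrightarrow> dist v (g v) < 1 \<Longrightarrow> g = (\<lambda>v. v)"
    and cocompact: "\<exists>R. \<forall>v. \<exists>g\<in>G. norm (g v) \<le> R"
begin

text \<open>A point of the quotient is encoded by a chosen representative of its orbit, tagged with
  0 to fit the carrier type. The predicate under \<open>SOME\<close> depends on the orbit alone, so
  points of one orbit get the same representative.\<close>

definition proj :: "(real, 'n) vec \<Rightarrow> nat \<times> (real, 'n) vec" where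
  "proj v = (0, SOME w. \<exists>g\<in>G. w = g v)"

lemma proj_mem_orbit: "\<exists>g\<in>G. snd (proj v) = g v"
  unfolding proj_def snd_conv by (rule someI_ex) (use id_mem in blast)

lemma proj_eq_iff: "proj v = proj w \<longleftrightarrow> (\<exists>g\<in>G. w = g v)"
proof
  assume "proj v = proj w"
  then obtain g h where "g \<in> G" "h \<in> G" "g v = h w"
    using proj_mem_orbit by metis
  then show "\<exists>g\<in>G. w = g v"
    using inverse_mem comp_mem by metis
next
  assume "\<exists>g\<in>G. w = g v"
  then obtain g where "g \<in> G" "w = g v" by blast
  then have "(\<exists>k\<in>G. u = k v) \<longleftrightarrow> (\<exists>k\<in>G. u = k w)" for u
    using inverse_mem comp_mem by metis
  then show "proj v = proj w"
    unfolding proj_def by simp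
qed

lemma proj_action: "g \<in> G \<Longrightarrow> proj (g v) = proj v"
  using proj_eq_iff by metis

lemma proj_snd_proj: "proj (snd (proj v)) = proj v"
  using proj_mem_orbit proj_action by metis

lemma proj_eq_imp_eq:
  assumes "proj v = proj w" "dist v w < 1"
  shows "v = w"
  using assms displacement by (metis proj_eq_iff)

lemma inj_on_proj_ball: "inj_on proj (ball v (1/4))"
proof (rule inj_onI)
  fix a b assume "a \<in> ball v (1/4)" "b \<in> ball v (1/4)" "proj a = proj b"
  moreover have "dist a b \<le> dist v a + dist v b"
    by (metis dist_commute dist_triangle)
  ultimately show "a = b"
    by (intro proj_eq_imp_eq) auto
qed

section \<open>Topology of the orbit space\<close>

definition quotient_space :: "(nat \<times> (real, 'n) vec) topology" where
  "quotient_space = quotient_topology euclidean proj"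

lemma topspace_quotient_space [simp]: "topspace quotient_space = range proj"
  by (simp add: quotient_space_def)

lemma openin_quotient_space:
  "openin quotient_space U \<longleftrightarrow> U \<subseteq> range proj \<and> open {v. proj v \<in> U}"
  by (simp add: quotient_space_def openin_quotient_topology)

lemma continuous_map_proj: "continuous_map euclidean quotient_space proj"
  unfolding quotient_space_def
  by (intro quotient_imp_continuous_map quotient_map_quotient_topology)

text \<open>The saturation of \<open>W\<close> is the union of its preimages under the group
  elements, and each of these is open.\<close>

lemma openin_proj_image:
  assumes "open W"
  shows "openin quotient_space (proj ` W)"
proof -
  have "{v. proj v \<in> proj ` W} = (\<Union>g\<in>G. g -` W)"
  proof -
    have "proj v \<in> proj ` W \<longleftrightarrow> (\<exists>g\<in>G. g v \<in> W)" for v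
      unfolding image_iff proj_eq_iff by blast
    then show ?thesis by auto
  qed
  moreover have "open (g -` W)" if "g \<in> G" for g
    by (rule open_vimage[OF assms affine_map_continuous[OF affine[OF that]]])
  ultimately show ?thesis
    by (auto simp: openin_quotient_space)
qed

lemma Hausdorff_quotient_space: "Hausdorff_space quotient_space"
  unfolding Hausdorff_space_def
proof (intro allI impI)
  fix x y assume "x \<in> topspace quotient_space \<and> y \<in> topspace quotient_space \<and> x \<noteq> y"
  then obtain v w where x: "x = proj v" and y: "y = proj w" and ne: "proj v \<noteq> proj w"
    by auto
  \<comment> \<open>At most one point of the orbit of \<open>w\<close> lies within 1/2 of
    \<open>v\<close>, since two of them would be less than 1 apart. If there is one,
    \<open>e\<close> is its distance from \<open>v\<close>, otherwise \<open>e\<close> is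
    1/2.\<close>
  have "\<exists>e>0. \<forall>g\<in>G. e \<le> dist v (g w)"
  proof (cases "\<exists>g\<in>G. dist v (g w) < 1/2")
    case True
    then obtain g where g: "g \<in> G" "dist v (g w) < 1/2" by blast
    have "dist v (g w) \<le> dist v (h w)" if h: "h \<in> G" for h
    proof (rule ccontr)
      assume less: "\<not> dist v (g w) \<le> dist v (h w)"
      have "dist (g w) (h w) \<le> dist v (g w) + dist v (h w)"
        by (metis dist_commute dist_triangle)
      then have "dist (g w) (h w) < 1"
        using less g by linarith
      then have "g w = h w"
        using proj_eq_imp_eq proj_action g h by metis
      then show False using less by simp
    qed
    moreover have "0 < dist v (g w)"
      using ne proj_action g by (metis zero_less_dist_iff)
    ultimately show ?thesis by blast
  next
    case False
    then show ?thesis by (intro exI[of _ "1/2"]) force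
  qed
  then obtain e where e: "e > 0" "\<And>g. g \<in> G \<Longrightarrow> e \<le> dist v (g w)" by blast
  \<comment> \<open>The group acts by isometries, so a common image of the two balls would bring
    some \<open>g w\<close> closer than \<open>e\<close> to \<open>v\<close>.\<close>
  have "disjnt (proj ` ball v (e/2)) (proj ` ball w (e/2))"
    unfolding disjnt_iff
  proof (intro allI notI, elim conjE imageE)
    fix z a b assume a: "z = proj a" "a \<in> ball v (e/2)" and b: "z = proj b" "b \<in> ball w (e/2)"
    obtain g where g: "g \<in> G" "a = g b"
      using a b proj_eq_iff by metis
    have "dist v (g w) \<le> dist v a + dist (g w) (g b)"
      using g by (metis dist_commute dist_triangle)
    also have "\<dots> < e"
      using a b g by (simp add: isometry)
    finally show False using e g by force
  qed
  then show "\<exists>U V. openin quotient_space U \<and> openin quotient_space V \<and> x \<in> U \<and> y \<in> V \<and> disjnt U V"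
    using e x y openin_proj_image
    by (intro exI[of _ "proj ` ball v (e/2)"] exI[of _ "proj ` ball w (e/2)"]) auto
qed

lemma second_countable_quotient_space: "second_countable quotient_space"
proof (rule second_countable_open_map_image)
  show "open_map euclidean quotient_space proj"
    by (auto simp: open_map_def openin_proj_image)
  show "continuous_map euclidean quotient_space proj"
    by (rule continuous_map_proj)
  show "proj ` topspace euclidean = topspace quotient_space"
    by simp
  show "second_countable (euclidean :: (real, 'n) vec topology)"
  proof -
    obtain B :: "(real, 'n) vec set set" where B: "countable B" "topological_basis B"
      using ex_countable_basis by blast
    have "\<exists>V\<in>B. x \<in> V \<and> V \<subseteq> U" if "open U" "x \<in> U" for x U
      using topological_basisE[OF B(2) that] by metis
    then have "\<forall>U x. openin euclidean U \<and> x \<in> U \<longrightarrow> (\<exists>V\<in>B. x \<in> V \<and> V \<subseteq> U)"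
      by (simp add: open_openin[symmetric])
    moreover have "openin euclidean V" if "V \<in> B" for V
      using topological_basis_open[OF B(2) that] by simp
    ultimately show ?thesis
      unfolding second_countable_def using B(1) by blast
  qed
qed

lemma compact_quotient_space: "compact_space quotient_space"
proof -
  obtain R where R: "\<And>v. \<exists>g\<in>G. norm (g v) \<le> R" using cocompact by blast
  have "range proj = proj ` cball 0 R"
  proof -
    have "proj v \<in> proj ` cball 0 R" for v
      using R[of v] proj_action by (metis dist_0_norm image_eqI mem_cball)
    then show ?thesis by blast
  qed
  moreover have "compactin quotient_space (proj ` cball 0 R)"
    by (intro image_compactin[OF _ continuous_map_proj]) simp
  ultimately show ?thesis
    by (simp add: compact_space_def)
qed

text \<open>A chart inverts \<open>proj\<close> on a small ball, which it moves to the ball around \<open>1\<close> in the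
  interior of the half-space.\<close>

definition chart :: "(real, 'n) vec \<Rightarrow> (nat \<times> (real, 'n) vec, 'n) chart" where
  "chart v = (proj ` ball v (1/4), \<lambda>x. inv_into (ball v (1/4)) proj x + (1 - v))"

definition quotient_manifold :: "(nat \<times> (real, 'n) vec, 'n) manifold" where
  "quotient_manifold = \<lparr>space_of = quotient_space, atlas = range chart\<rparr>"

lemma space_quotient_manifold [simp]: "space_of quotient_manifold = quotient_space"
  and atlas_quotient_manifold [simp]: "atlas quotient_manifold = range chart"
  by (simp_all add: quotient_manifold_def)

lemma fst_chart: "fst (chart v) = proj ` ball v (1/4)"
  by (simp add: chart_def)

lemma snd_chart: "a \<in> ball v (1/4) \<Longrightarrow> snd (chart v) (proj a) = a + (1 - v)"
  using inv_into_f_f[OF inj_on_proj_ball] by (simp add: chart_def)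

lemma chart_image: "snd (chart v) ` S = (\<lambda>a. a + (1 - v)) ` {a \<in> ball v (1/4). proj a \<in> S}"
  if "S \<subseteq> fst (chart v)"
proof -
  have "S = proj ` {a \<in> ball v (1/4). proj a \<in> S}"
    using that by (auto simp: fst_chart)
  then have "snd (chart v) ` S = (\<lambda>a. snd (chart v) (proj a)) ` {a \<in> ball v (1/4). proj a \<in> S}"
    by (metis image_image)
  then show ?thesis
    by (simp add: snd_chart cong: image_cong_simp)
qed

lemma mem_ball_chart_iff:
  "z \<in> ball 1 (1/4) \<longleftrightarrow> z - (1 - v) \<in> ball v (1/4)" for z v :: "(real, 'n) vec"
proof -
  have "v - (z - (1 - v)) = 1 - z" by simp
  then show ?thesis by (simp only: mem_ball dist_norm)
qed

lemma chart_range: "snd (chart v) ` fst (chart v) = ball 1 (1/4)"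
proof -
  have "(\<lambda>a. a + (1 - v)) ` ball v (1/4) = ball 1 (1/4)"
    by (simp add: ball_translation[symmetric] add.commute[of _ "1 - v"])
  moreover have "{a \<in> ball v (1/4). proj a \<in> fst (chart v)} = ball v (1/4)"
    by (auto simp: fst_chart)
  ultimately show ?thesis
    using chart_image[of "fst (chart v)" v] by simp
qed

text \<open>Here \<open>1\<close> is the all-ones vector, so the first coordinate stays above 3/4.
  This keeps all charts off the boundary hyperplane.\<close>

lemma ball_subset_half_space: "ball 1 (1/4) \<subseteq> {z :: (real, 'n) vec. 0 < z $ 1}"
proof
  fix z :: "(real, 'n) vec" assume "z \<in> ball 1 (1/4)"
  then have "\<bar>(1 - z) $ 1\<bar> < 1/4"
    using component_le_norm_cart[of "1 - z" 1] by (simp add: dist_norm)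
  then show "z \<in> {z. 0 < z $ 1}"
    by (auto simp: abs_if split: if_splits)
qed

lemma chart_inv_chart:
  assumes "z \<in> ball 1 (1/4)"
  shows "chart_inv (chart v) z = proj (z - (1 - v))"
proof -
  let ?a = "z - (1 - v)"
  have a: "?a \<in> ball v (1/4)"
    using assms mem_ball_chart_iff by blast
  have "inj_on (snd (chart v)) (fst (chart v))"
    by (rule inj_onI) (unfold fst_chart, elim imageE, simp add: snd_chart)
  then have "chart_inv (chart v) (snd (chart v) (proj ?a)) = proj ?a"
    unfolding chart_inv_def by (rule inv_into_f_f) (use a in \<open>auto simp: fst_chart\<close>)
  then show ?thesis
    using snd_chart[OF a] by simp
qed

text \<open>The inverse of the chart is a translation followed by \<open>proj\<close>. It is
  continuous because \<open>proj\<close> is, and the chart itself is continuous because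
  \<open>proj\<close> is open.\<close>

lemma is_chart_chart: "is_chart quotient_space (chart v)"
  unfolding is_chart_def chart_range
proof (intro conjI)
  show o: "openin quotient_space (fst (chart v))"
    by (simp add: fst_chart openin_proj_image)
  have "ball 1 (1/4) \<subseteq> (half_space :: (real, 'n) vec set)"
    using ball_subset_half_space by (force simp: half_space_def)
  then show "openin (top_of_set half_space) (ball 1 (1/4) :: (real, 'n) vec set)"
    by (meson open_ball open_subset)
  show "homeomorphic_map (subtopology quotient_space (fst (chart v))) (top_of_set (ball 1 (1/4)))
     (snd (chart v))"
    unfolding homeomorphic_map_maps homeomorphic_maps_def
  proof (intro exI[of _ "\<lambda>z. proj (z - (1 - v))"] conjI ballI)
    have sub: "topspace quotient_space \<inter> fst (chart v) = fst (chart v)"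
      by (auto simp: fst_chart)
    show "continuous_map (subtopology quotient_space (fst (chart v))) (top_of_set (ball 1 (1/4)))
       (snd (chart v))"
      unfolding continuous_map_alt
    proof (intro conjI allI impI)
      show "snd (chart v) \<in> topspace (subtopology quotient_space (fst (chart v)))
          \<rightarrow> topspace (top_of_set (ball 1 (1/4)))"
        using chart_range[of v] by auto
      fix U assume "openin (top_of_set (ball (1::(real, 'n) vec) (1/4))) U"
      then have U: "open U" "U \<subseteq> ball 1 (1/4)"
        by (auto simp: openin_open_eq)
      have "open ((\<lambda>z. z - (1 - v)) ` U)"
        using open_translation_subtract[OF U(1), of "1 - v"] by simp
      moreover have "snd (chart v) -` U \<inter> fst (chart v)
          = proj ` ((\<lambda>z. z - (1 - v)) ` U)"
      proof (intro set_eqI iffI)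
        fix x assume "x \<in> snd (chart v) -` U \<inter> fst (chart v)"
        then obtain a where "a \<in> ball v (1/4)" "x = proj a" "a + (1 - v) \<in> U"
          by (auto simp: fst_chart snd_chart)
        then show "x \<in> proj ` ((\<lambda>z. z - (1 - v)) ` U)"
          by (force simp: image_iff)
      next
        fix x assume "x \<in> proj ` ((\<lambda>z. z - (1 - v)) ` U)"
        then obtain z where z: "z \<in> U" "x = proj (z - (1 - v))" by auto
        then have "z - (1 - v) \<in> ball v (1/4)"
          using U mem_ball_chart_iff by blast
        then show "x \<in> snd (chart v) -` U \<inter> fst (chart v)"
          using z snd_chart[of "z - (1 - v)" v] by (auto simp: fst_chart)
      qed
      ultimately have "openin quotient_space (snd (chart v) -` U \<inter> fst (chart v))"
        by (simp add: openin_proj_image)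
      then show "openin (subtopology quotient_space (fst (chart v)))
          (snd (chart v) -` U \<inter> topspace (subtopology quotient_space (fst (chart v))))"
        using o sub by (simp add: openin_open_subtopology)
    qed
    show "continuous_map (top_of_set (ball 1 (1/4))) (subtopology quotient_space (fst (chart v)))
       (\<lambda>z. proj (z - (1 - v)))"
      unfolding continuous_map_in_subtopology
    proof
      have "continuous_map euclidean quotient_space (\<lambda>z. proj (z - (1 - v)))"
        using continuous_map_compose[of euclidean euclidean "\<lambda>z. z - (1 - v)", OF _ continuous_map_proj]
        by (simp add: o_def continuous_intros)
      then show "continuous_map (top_of_set (ball 1 (1/4))) quotient_space (\<lambda>z. proj (z - (1 - v)))"
        using continuous_map_from_subtopology by blast
      show "(\<lambda>z. proj (z - (1 - v))) \<in> topspace (top_of_set (ball 1 (1/4))) \<rightarrow> fst (chart v)"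
        using mem_ball_chart_iff by (auto simp: fst_chart)
    qed
  next
    fix x assume "x \<in> topspace (subtopology quotient_space (fst (chart v)))"
    then show "proj (snd (chart v) x - (1 - v)) = x"
      by (auto simp: fst_chart snd_chart)
  next
    fix z assume "z \<in> topspace (top_of_set (ball (1::(real, 'n) vec) (1/4)))"
    then have "z - (1 - v) \<in> ball v (1/4)"
      using mem_ball_chart_iff by auto
    then show "snd (chart v) (proj (z - (1 - v))) = z"
      using snd_chart[of "z - (1 - v)" v] by simp
  qed
qed

lemma boundary_quotient_manifold: "boundary quotient_manifold = {}"
proof -
  have "snd (chart v) x $ 1 \<noteq> 0" if "x \<in> fst (chart v)" for v x
    using that chart_range[of v] ball_subset_half_space by force
  then show ?thesis
    by (auto simp: boundary_def charts_at_def)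
qed

end

section \<open>Maps covered by affine maps\<close>

lemma affine_map_diff: "affine_map g \<Longrightarrow> g u - g v = g (u - v) - g 0"
  by (auto simp: affine_map_def linear_diff linear_0)

text \<open>\<open>A\<close> is a lift of \<open>f\<close> to the universal covers; the smooth
  properties of \<open>f\<close> are read off from it.\<close>

locale affine_covering_map =
  dom: free_crystallographic G + cod: free_crystallographic H
  for G :: "(real^'m::{finite,one} \<Rightarrow> real^'m::{finite,one}) set"
    and H :: "(real^'n::{finite,one} \<Rightarrow> real^'n::{finite,one}) set" +
  fixes A :: "real^'m::{finite,one} \<Rightarrow> real^'n::{finite,one}"
    and f :: "nat \<times> (real^'m::{finite,one}) \<Rightarrow> nat \<times> (real^'n::{finite,one})"
  assumes affine_A: "affine_map A"
    and f_proj: "f (dom.proj a) = cod.proj (A a)"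
begin

text \<open>Some deck transformation \<open>h\<close> carries the value of \<open>A\<close> into the
  ball of the target chart. The same \<open>h\<close> serves on the open set where \<open>h\<close>
  after \<open>A\<close> stays in that ball, so near \<open>z\<close> the local representative is
  affine.\<close>

lemma local_rep_affine:
  assumes z: "z \<in> ball 1 (1/4)" and y: "cod.proj (A (z - (1 - v))) \<in> fst (cod.chart w)"
  obtains h W where "h \<in> H" "h (A (z - (1 - v))) \<in> ball w (1/4)" "open W" "z \<in> W"
    "\<And>q. q \<in> W \<inter> ball 1 (1/4) \<Longrightarrow>
       local_rep f (dom.chart v) (cod.chart w) q = h (A (q - (1 - v))) + (1 - w)"
proof -
  obtain b where b: "b \<in> ball w (1/4)" "cod.proj (A (z - (1 - v))) = cod.proj b"
    using y by (auto simp: cod.fst_chart)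
  then obtain h where h: "h \<in> H" "b = h (A (z - (1 - v)))"
    unfolding cod.proj_eq_iff by blast
  let ?g = "\<lambda>q. h (A (q - (1 - v)))"
  have "affine_map ?g"
    by (intro affine_map_diff_left affine_map_comp[OF cod.affine[OF h(1)] affine_A])
  then have "open (?g -` ball w (1/4))"
    by (intro open_vimage affine_map_continuous open_ball)
  moreover have "local_rep f (dom.chart v) (cod.chart w) q = ?g q + (1 - w)"
    if "q \<in> ?g -` ball w (1/4) \<inter> ball 1 (1/4)" for q
  proof -
    have "local_rep f (dom.chart v) (cod.chart w) q = snd (cod.chart w) (cod.proj (A (q - (1 - v))))"
      using that by (simp add: local_rep_def dom.chart_inv_chart f_proj)
    also have "\<dots> = snd (cod.chart w) (cod.proj (?g q))"
      using cod.proj_action[OF h(1)] by simp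
    also have "\<dots> = ?g q + (1 - w)"
      using that by (intro cod.snd_chart) simp
    finally show ?thesis .
  qed
  ultimately show ?thesis
    using that[of h "?g -` ball w (1/4)"] b h by blast
qed

lemma smooth_on_local_rep:
  "smooth_on (snd (dom.chart v) ` {x \<in> fst (dom.chart v). f x \<in> fst (cod.chart w)})
     (local_rep f (dom.chart v) (cod.chart w))"
  (is "smooth_on ?S ?F")
proof (rule smooth_on_locally_affine)
  fix z assume "z \<in> ?S"
  then obtain x where x: "x \<in> fst (dom.chart v)" "f x \<in> fst (cod.chart w)"
    "z = snd (dom.chart v) x" by blast
  then obtain a where a: "a \<in> ball v (1/4)" "x = dom.proj a"
    unfolding dom.fst_chart by blast
  then have z: "z = a + (1 - v)"
    using x dom.snd_chart by simp
  have S: "?S \<subseteq> ball 1 (1/4)"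
    using dom.chart_range[of v] by blast
  then have zb: "z \<in> ball 1 (1/4)"
    using \<open>z \<in> ?S\<close> by blast
  have "z - (1 - v) = a"
    unfolding z by simp
  then have "cod.proj (A (z - (1 - v))) \<in> fst (cod.chart w)"
    using x(2) f_proj[of a] a(2) by simp
  from local_rep_affine[OF zb this] obtain h W where hW: "h \<in> H" "open W" "z \<in> W"
    "\<And>q. q \<in> W \<inter> ball 1 (1/4) \<Longrightarrow> ?F q = h (A (q - (1 - v))) + (1 - w)"
    by metis
  have "affine_map (\<lambda>q. h (A (q - (1 - v))) + (1 - w))"
    by (intro affine_map_diff_left affine_map_add_right affine_map_comp[OF cod.affine[OF hW(1)] affine_A])
  moreover have "\<forall>q\<in>?S \<inter> W. h (A (q - (1 - v))) + (1 - w) = ?F q"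
  proof
    fix q assume "q \<in> ?S \<inter> W"
    then have "q \<in> W \<inter> ball 1 (1/4)"
      using S by blast
    from hW(4)[OF this] show "h (A (q - (1 - v))) + (1 - w) = ?F q" ..
  qed
  ultimately show "\<exists>W g. open W \<and> z \<in> W \<and> affine_map g \<and> (\<forall>q\<in>?S \<inter> W. g q = ?F q)"
    using hW(2,3) by blast
qed

lemma continuous_map_f: "continuous_map dom.quotient_space cod.quotient_space f"
proof (rule continuous_compose_quotient_map)
  show "quotient_map euclidean dom.quotient_space dom.proj"
    unfolding dom.quotient_space_def by (rule quotient_map_quotient_topology)
  have "f \<circ> dom.proj = cod.proj \<circ> A"
    by (auto simp: f_proj)
  moreover have "continuous_map euclidean euclidean A"
    using affine_map_continuous[OF affine_A] by simp
  ultimately show "continuous_map euclidean cod.quotient_space (f \<circ> dom.proj)"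
    using cod.continuous_map_proj continuous_map_compose by metis
qed

lemma smooth_map_f: "smooth_map dom.quotient_manifold cod.quotient_manifold f"
  unfolding smooth_map_def
  using smooth_on_local_rep continuous_map_f by auto

text \<open>The local representative is affine near the point, so its derivative is the linear part
  of \<open>h\<close> after \<open>A\<close>. The chart image is an open ball, hence the derivative
  within it is the ordinary one.\<close>

lemma differential:
  assumes "x \<in> fst (dom.chart v)" "f x \<in> fst (cod.chart w)"
  obtains a h where "dom.proj a = x" "h \<in> H" "h (A a) \<in> ball w (1/4)"
    "differential_in f (dom.chart v) (cod.chart w) x = (\<lambda>u. h (A u) - h (A 0))"
proof -
  obtain a where a: "a \<in> ball v (1/4)" "x = dom.proj a"
    using assms(1) unfolding dom.fst_chart by blast
  define z where "z = a + (1 - v)"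
  have z: "z = snd (dom.chart v) x" "z - (1 - v) = a"
    using a dom.snd_chart by (simp_all add: z_def)
  have zb: "z \<in> ball 1 (1/4)"
    using z assms(1) dom.chart_range[of v] by blast
  have "cod.proj (A (z - (1 - v))) \<in> fst (cod.chart w)"
    using assms a z f_proj by simp
  from local_rep_affine[OF zb this] obtain h W where hW: "h \<in> H" "h (A a) \<in> ball w (1/4)"
    "open W" "z \<in> W"
    "\<And>q. q \<in> W \<inter> ball 1 (1/4) \<Longrightarrow>
       local_rep f (dom.chart v) (cod.chart w) q = h (A (q - (1 - v))) + (1 - w)"
    using z by metis
  let ?g = "\<lambda>q. h (A (q - (1 - v))) + (1 - w)"
  have aff: "affine_map (\<lambda>u. h (A u))"
    by (intro affine_map_comp[OF cod.affine[OF hW(1)] affine_A])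
  then have "affine_map ?g"
    by (intro affine_map_diff_left affine_map_add_right)
  from affine_map_has_derivative[OF this]
  have "(?g has_derivative (\<lambda>u. ?g u - ?g 0)) (at z)" .
  moreover have "(\<lambda>u. ?g u - ?g 0) = (\<lambda>u. h (A u) - h (A 0))"
    using affine_map_diff[OF aff, of "_ - (1 - v)" "0 - (1 - v)"] by simp
  ultimately have "(?g has_derivative (\<lambda>u. h (A u) - h (A 0))) (at z)"
    by simp
  then have "(local_rep f (dom.chart v) (cod.chart w) has_derivative (\<lambda>u. h (A u) - h (A 0))) (at z)"
    by (rule has_derivative_transform_within_open[of _ _ _ _ "W \<inter> ball 1 (1/4)"])
      (use hW zb in auto)
  then have "differential_in f (dom.chart v) (cod.chart w) x = (\<lambda>u. h (A u) - h (A 0))"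
    unfolding differential_in_def dom.chart_range z(1)[symmetric] at_within_open[OF zb open_ball]
    using frechet_derivative_at by metis
  then show ?thesis
    using that a hW by blast
qed

lemma immersion_f:
  assumes "inj A"
  shows "immersion dom.quotient_manifold cod.quotient_manifold f"
proof -
  have "inj (differential_in f c d x)"
    if cd: "c \<in> charts_at dom.quotient_manifold x" "d \<in> charts_at cod.quotient_manifold (f x)" for x c d
  proof -
    obtain v w where vw: "c = dom.chart v" "d = cod.chart w"
      and "x \<in> fst (dom.chart v)" "f x \<in> fst (cod.chart w)"
      using cd by (auto simp: charts_at_def)
    from differential[OF this(3,4)] obtain h
      where h: "h \<in> H" "differential_in f c d x = (\<lambda>u. h (A u) - h (A 0))"
      unfolding vw by blast
    have "u = u'" if "h (A u) = h (A u')" for u u'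
      using that cod.isometry[OF h(1)] assms by (metis dist_eq_0_iff injD)
    then show ?thesis
      unfolding h inj_def by auto
  qed
  then show ?thesis
    using smooth_map_f by (simp add: immersion_def)
qed

text \<open>All sheets through a point are compared at one point \<open>q\<close> of the universal cover.\<close>

lemma generic_immersionI:
  assumes "inj A"
    and position: "\<And>q V. (\<And>x. x \<in> fibre dom.quotient_manifold f (cod.proj q) \<Longrightarrow>
        \<exists>a h. dom.proj a = x \<and> h \<in> H \<and> h (A a) = q \<and> V x = range (\<lambda>u. h (A u) - h (A 0))) \<Longrightarrow>
      general_position (fibre dom.quotient_manifold f (cod.proj q)) V"
  shows "generic_immersion dom.quotient_manifold cod.quotient_manifold f"
proof -
  have "general_position (fibre dom.quotient_manifold f y) (\<lambda>x. range (differential_in f (c x) d x))"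
    if d: "d \<in> charts_at cod.quotient_manifold y"
      and c: "\<And>x. x \<in> fibre dom.quotient_manifold f y \<Longrightarrow> c x \<in> charts_at dom.quotient_manifold x"
    for y c d
  proof -
    obtain w where w: "d = cod.chart w" "y \<in> fst (cod.chart w)"
      using d by (auto simp: charts_at_def)
    then obtain q where q: "q \<in> ball w (1/4)" "y = cod.proj q"
      unfolding cod.fst_chart by blast
    show ?thesis
      unfolding q(2)
    proof (rule position)
      fix x assume "x \<in> fibre dom.quotient_manifold f (cod.proj q)"
      then have x: "x \<in> fibre dom.quotient_manifold f y" "f x = y"
        by (auto simp: fibre_def q)
      obtain v where v: "c x = dom.chart v" "x \<in> fst (dom.chart v)"
        using c[OF x(1)] by (auto simp: charts_at_def)
      have "f x \<in> fst (cod.chart w)"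
        using w(2) x(2) by simp
      from differential[OF v(2) this] obtain a h
        where ah: "dom.proj a = x" "h \<in> H" "h (A a) \<in> ball w (1/4)"
          "differential_in f (c x) d x = (\<lambda>u. h (A u) - h (A 0))"
        unfolding v(1) w(1) by blast
      \<comment> \<open>Both \<open>h (A a)\<close> and \<open>q\<close> lie in the ball around
        \<open>w\<close>, where \<open>proj\<close> is injective, so equal projections identify
        them.\<close>
      have "cod.proj (h (A a)) = cod.proj q"
        using cod.proj_action[OF ah(2), of "A a"] f_proj[of a] ah(1) x(2) q(2) by simp
      then have "h (A a) = q"
        using ah(3) q(1) by (rule inj_onD[OF cod.inj_on_proj_ball])
      then show "\<exists>a h. dom.proj a = x \<and> h \<in> H \<and> h (A a) = q \<and>
          range (differential_in f (c x) d x) = range (\<lambda>u. h (A u) - h (A 0))"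
        using ah(1,2,4) \<open>h (A a) = q\<close> by (intro exI[of _ a] exI[of _ h]) simp
    qed
  qed
  then show ?thesis
    using immersion_f[OF assms(1)]
    by (simp add: generic_immersion_def dom.boundary_quotient_manifold cod.boundary_quotient_manifold)
qed

end

section \<open>Smooth structure of the orbit space\<close>

context free_crystallographic
begin

lemma smooth_manifold_quotient_manifold: "smooth_manifold quotient_manifold"
proof -
  \<comment> \<open>Transition maps are the local representatives of the identity, which is covered
    by the identity.\<close>
  interpret I: affine_covering_map G G "\<lambda>v. v" "\<lambda>x. x"
    by unfold_locales (auto intro: affine_mapI[OF linear_id, of _ 0])
  have "smooth_on (snd (chart v) ` (fst (chart v) \<inter> fst (chart w))) (snd (chart w) \<circ> chart_inv (chart v))"
    for v w
    using I.smooth_on_local_rep[of v w] by (simp add: local_rep_def Int_def o_def)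
  moreover have "range proj = (\<Union>v. fst (chart v))"
    by (auto simp: fst_chart)
  ultimately show ?thesis
    using Hausdorff_quotient_space second_countable_quotient_space is_chart_chart
    by (auto simp: smooth_manifold_def)
qed

end

section \<open>Labellings of the double points\<close>

lemma topspace_conf2_top:
  "topspace (conf2_top X f) = {(a, b). a \<in> topspace X \<and> b \<in> topspace X \<and> a \<noteq> b \<and> f a = f b}"
  by (auto simp: conf2_top_def)

lemma unordered_eq_iff: "unordered p = unordered q \<longleftrightarrow> q = p \<or> q = prod.swap p"
  by (auto simp: unordered_def doubleton_eq_iff prod_eq_iff)

lemma continuous_map_swap_conf2: "continuous_map (conf2_top X f) (conf2_top X f) prod.swap"
proof -
  have "continuous_map (prod_topology X X) (prod_topology X X) (\<lambda>p. (snd p, fst p))"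
    by (intro continuous_map_pairedI continuous_map_fst continuous_map_snd)
  then show ?thesis
    unfolding conf2_top_def continuous_map_in_subtopology prod.swap_def
    by (auto simp: continuous_map_from_subtopology)
qed

text \<open>The saturation of \<open>U\<close> is \<open>U\<close> together with its image under the
  swap, a homeomorphism.\<close>

lemma open_map_unordered: "open_map (conf2_top X f) (uconf2_top X f) unordered"
  unfolding open_map_def
proof (intro allI impI)
  fix U assume U: "openin (conf2_top X f) U"
  let ?C = "conf2_top X f"
  have "{p \<in> topspace ?C. unordered p \<in> unordered ` U} = U \<union> {p \<in> topspace ?C. prod.swap p \<in> U}"
    using openin_subset[OF U] by (auto simp: image_iff unordered_eq_iff)
  moreover have "openin ?C {p \<in> topspace ?C. prod.swap p \<in> U}"
    using continuous_map_swap_conf2 U by (rule openin_continuous_map_preimage)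
  ultimately show "openin (uconf2_top X f) (unordered ` U)"
    using U openin_subset[OF U] by (auto simp: uconf2_top_def openin_quotient_topology)
qed

text \<open>The sign \<open>s\<close> tells the two orders of an unordered pair apart, so pairing it
  with \<open>unordered\<close> gives a bijection onto the product. This map is open because
  \<open>unordered\<close> is open and \<open>s\<close> is locally constant.\<close>

lemma mu2_vanishesI:
  fixes s :: "'a \<times> 'a \<Rightarrow> bool"
  assumes s: "continuous_map (conf2_top X f) (discrete_topology UNIV) s"
    and swap: "\<And>p. p \<in> topspace (conf2_top X f) \<Longrightarrow> s (prod.swap p) \<longleftrightarrow> \<not> s p"
  shows "mu2_vanishes X f"
  unfolding mu2_vanishes_def trivial_double_covering_def
proof (intro exI[of _ "\<lambda>p. (unordered p, s p)"] conjI ballI)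
  let ?C = "conf2_top X f" and ?U = "uconf2_top X f"
  have q: "continuous_map ?C ?U unordered"
    unfolding uconf2_top_def by (intro quotient_imp_continuous_map quotient_map_quotient_topology)
  have swapC: "prod.swap p \<in> topspace ?C" if "p \<in> topspace ?C" for p
    using that by (auto simp: topspace_conf2_top)
  show "homeomorphic_map ?C (prod_topology ?U (discrete_topology UNIV)) (\<lambda>p. (unordered p, s p))"
  proof (rule bijective_open_imp_homeomorphic_map)
    show "continuous_map ?C (prod_topology ?U (discrete_topology UNIV)) (\<lambda>p. (unordered p, s p))"
      using q s by (intro continuous_map_pairedI)
    show "inj_on (\<lambda>p. (unordered p, s p)) (topspace ?C)"
    proof (rule inj_onI)
      fix p q assume "p \<in> topspace ?C" "(unordered p, s p) = (unordered q, s q)"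
      then show "p = q"
        using swap[of p] unordered_eq_iff[of p q] by auto
    qed
    show "open_map ?C (prod_topology ?U (discrete_topology UNIV)) (\<lambda>p. (unordered p, s p))"
      unfolding open_map_def
    proof (intro allI impI)
      fix W assume W: "openin ?C W"
      have "(\<lambda>p. (unordered p, s p)) ` W = (\<Union>b. unordered ` {p \<in> W. s p = b} \<times> {b})"
        by auto
      moreover have "openin ?C {p \<in> W. s p = b}" for b
      proof -
        have "{p \<in> W. s p = b} = W \<inter> {p \<in> topspace ?C. s p \<in> {b}}"
          using openin_subset[OF W] by auto
        then show ?thesis
          using openin_continuous_map_preimage[OF s, of "{b}"] W by auto
      qed
      then have "openin (prod_topology ?U (discrete_topology UNIV)) (unordered ` {p \<in> W. s p = b} \<times> {b})" for b
        using open_map_unordered by (auto simp: openin_prod_Times_iff open_map_def)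
      ultimately show "openin (prod_topology ?U (discrete_topology UNIV)) ((\<lambda>p. (unordered p, s p)) ` W)"
        by auto
    qed
    have "(unordered p, b) \<in> (\<lambda>p. (unordered p, s p)) ` topspace ?C" if "p \<in> topspace ?C" for p b
    proof (cases "s p = b")
      case False
      then have "s (prod.swap p) = b"
        using swap that by auto
      moreover have "unordered (prod.swap p) = unordered p"
        by (auto simp: unordered_def)
      ultimately show ?thesis
        using swapC[OF that] by (intro image_eqI[of _ _ "prod.swap p"]) auto
    qed (use that in auto)
    then show "(\<lambda>p. (unordered p, s p)) ` topspace ?C = topspace (prod_topology ?U (discrete_topology UNIV))"
      by (auto simp: uconf2_top_def)
  qed
qed simp

text \<open>Having equal labels is a relation in \<open>nu_relations\<close>: a locally constant
  label is constant on components, and \<open>triple\<close> makes clause (iii) vacuous. The least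
  relation is contained in it and therefore relates no consecutive pairs of a triple point.\<close>

lemma nu3_vanishesI:
  fixes l :: "'a \<times> 'a \<Rightarrow> 'l"
  assumes l: "continuous_map (conf2_top X f) (discrete_topology UNIV) l"
    and swap: "\<And>p q. p \<in> topspace (conf2_top X f) \<Longrightarrow> q \<in> topspace (conf2_top X f) \<Longrightarrow> l p = l q \<Longrightarrow>
      l (prod.swap p) = l (prod.swap q)"
    and triple: "\<And>a b c. {a, b, c} \<in> uconf3 X f \<Longrightarrow> l (a, b) \<noteq> l (b, c)"
  shows "nu3_vanishes X f"
proof -
  define R where "R = {(p, q). p \<in> S23 X f \<and> q \<in> S23 X f \<and> l (fst p) = l (fst q)}"
  have "l p = l q" if pq: "connected_component_of (conf2_top X f) p q" for p q
  proof -
    obtain T where "connectedin (conf2_top X f) T" "p \<in> T" "q \<in> T"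
      using pq by (auto simp: connected_component_of_def)
    then show ?thesis
      using connectedin_continuous_map_image[OF l] by (auto simp: connectedin_discrete_topology)
  qed
  then have component: "(((a, b), T1), ((c, d), T2)) \<in> R"
    if "((a, b), T1) \<in> S23 X f" "((c, d), T2) \<in> S23 X f"
      "connected_component_of (conf2_top X f) (a, b) (c, d)" for a b c d T1 T2
    using that by (auto simp: R_def)
  have "equiv (S23 X f) R"
    by (rule equivI) (auto simp: R_def refl_on_def sym_def trans_def)
  moreover have "(((b, a), T1), ((d, c), T2)) \<in> R" if "(((a, b), T1), ((c, d), T2)) \<in> R" for a b c d T1 T2
  proof -
    have "l (b, a) = l (d, c)"
      using that swap[of "(a, b)" "(c, d)"] by (auto simp: R_def S23_def)
    then show ?thesis
      using that by (auto simp: R_def S23_def topspace_conf2_top)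
  qed
  moreover have none: "(((a, b), {a, b, c}), ((b, c), {a, b, c})) \<notin> R" for a b c
    using triple[of a b c] by (auto simp: R_def S23_def)
  ultimately have "R \<in> nu_relations X f"
    unfolding nu_relations_def using component by blast
  then show ?thesis
    unfolding nu3_vanishes_def using nu_rel_least(2) none by blast
qed

lemma continuous_map_discreteI:
  fixes l :: "'a \<Rightarrow> 'l"
  assumes "\<And>p. p \<in> topspace X \<Longrightarrow> \<exists>N. openin X N \<and> p \<in> N \<and> (\<forall>q\<in>N. l q = l p)"
  shows "continuous_map X (discrete_topology UNIV) l"
  unfolding continuous_map
proof (intro conjI allI impI)
  fix U :: "'l set" assume "openin (discrete_topology UNIV) U"
  show "openin X {p \<in> topspace X. l p \<in> U}"
  proof (subst openin_subopen, intro ballI)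
    fix p assume p: "p \<in> {p \<in> topspace X. l p \<in> U}"
    then obtain N where N: "openin X N" "p \<in> N" "\<forall>q\<in>N. l q = l p"
      using assms by blast
    have "N \<subseteq> {p \<in> topspace X. l p \<in> U}"
    proof
      fix q assume "q \<in> N"
      moreover from this have "l q = l p" using N(3) by blast
      ultimately show "q \<in> {p \<in> topspace X. l p \<in> U}"
        using p openin_subset[OF N(1)] by auto
    qed
    then show "\<exists>N. openin X N \<and> p \<in> N \<and> N \<subseteq> {p \<in> topspace X. l p \<in> U}"
      using N by blast
  qed
qed simp

section \<open>The Hantzsche--Wendt group and an immersed torus\<close>

definition sg :: "int \<Rightarrow> int" where
  "sg k = (if even k then 1 else - 1)"

text \<open>If \<open>a + b + c\<close> is even, then either all three are even and the map is a
  translation, or exactly two are odd and the linear part is a half-turn about a coordinate axis. In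
  the latter case the translation along that axis is odd, so the map is a screw motion without fixed
  points.\<close>

definition hw :: "int \<Rightarrow> int \<Rightarrow> int \<Rightarrow> real^3 \<Rightarrow> real^3" where
  "hw a b c v = vector [sg c * v $ 1 + a, sg a * v $ 2 + b, sg b * v $ 3 + c]"

text \<open>Without the parity condition the action would not be free: \<open>hw 1 1 1\<close> has a fixed point.\<close>

definition hantzsche_wendt :: "(real^3 \<Rightarrow> real^3) set" where
  "hantzsche_wendt = {hw a b c | a b c. even (a + b + c)}"

text \<open>The stabilizer of the plane, read in the first two coordinates, consists of these shifts.\<close>

definition even_shift :: "int \<Rightarrow> int \<Rightarrow> real^2 \<Rightarrow> real^2" where
  "even_shift m n v = vector [v $ 1 + 2 * m, v $ 2 + 2 * n]"

definition even_shifts :: "(real^2 \<Rightarrow> real^2) set" where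
  "even_shifts = {even_shift m n | m n. True}"

lemma hw_nth [simp]:
  "hw a b c v $ 1 = sg c * v $ 1 + a" "hw a b c v $ 2 = sg a * v $ 2 + b"
  "hw a b c v $ 3 = sg b * v $ 3 + c"
  by (simp_all add: hw_def)

lemma even_shift_nth [simp]:
  "even_shift m n v $ 1 = v $ 1 + 2 * m" "even_shift m n v $ 2 = v $ 2 + 2 * n"
  by (simp_all add: even_shift_def)

lemma sg_compose: "sg (x + sg y * z) = sg x * sg z"
  by (simp add: sg_def)

lemma sg_square: "sg x * (sg x * y) = y" "sg x * sg x = 1"
  by (simp_all add: sg_def)

lemma sg_uminus_mult: "sg (- (sg y * z)) = sg z"
  by (simp add: sg_def)

lemma hw_hw: "hw a b c (hw a' b' c' v) = hw (a + sg c * a') (b + sg a * b') (c + sg b * c') v"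
  by (simp add: vec_eq_iff forall_3 sg_compose) (simp add: algebra_simps)

lemma even_hw_compose:
  "even (a + b + c) \<Longrightarrow> even (a' + b' + c') \<Longrightarrow> even (a + sg c * a' + (b + sg a * b') + (c + sg b * c'))"
  by (auto simp: sg_def)

lemma hw_inverse: "hw (- (sg c * a)) (- (sg a * b)) (- (sg b * c)) (hw a b c v) = v"
  by (simp add: vec_eq_iff forall_3 hw_hw sg_uminus_mult sg_square) (simp add: sg_def)

lemma hw_0: "hw 0 0 0 = (\<lambda>v. v)"
  by (auto simp: vec_eq_iff forall_3 sg_def)

lemma dist_hw: "dist (hw a b c v) (hw a b c w) = dist v w"
proof -
  have "dist (sg k * x + i) (sg k * y + i) = dist x y" for k i and x y :: real
    by (auto simp: sg_def dist_real_def)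
  then show ?thesis
    by (simp add: dist_vec_def L2_set_def sum_3)
qed

lemma affine_map_hw: "affine_map (hw a b c)"
proof (rule affine_mapI)
  show "linear (\<lambda>v :: real^3. vector [sg c * v $ 1, sg a * v $ 2, sg b * v $ 3] :: real^3)"
    by (rule linearI) (simp_all add: vec_eq_iff forall_3 algebra_simps)
  show "hw a b c v = vector [sg c * v $ 1, sg a * v $ 2, sg b * v $ 3] + vector [a, b, c]" for v
    by (simp add: vec_eq_iff forall_3)
qed

lemma dist_nth_less: "dist v w < e \<Longrightarrow> \<bar>v $ i - w $ i\<bar> < e" for v w :: "real^'k"
  using component_le_norm_cart[of "v - w" i] by (simp add: dist_norm)

text \<open>A coordinate that keeps its sign moves by an integer, which must be 0 if the
  displacement is below 1. For a half-turn this contradicts the odd translation along the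
  axis.\<close>

lemma hw_displacement:
  assumes "even (a + b + c)" and "dist v (hw a b c v) < 1"
  shows "a = 0 \<and> b = 0 \<and> c = 0"
proof -
  have *: "k = 0" if "even l" "\<bar>x - (sg l * x + k)\<bar> < 1" for k l :: int and x :: real
    using that by (simp add: sg_def)
  have "even c \<longrightarrow> a = 0" "even a \<longrightarrow> b = 0" "even b \<longrightarrow> c = 0"
    using *[of c "v $ 1" a] *[of a "v $ 2" b] *[of b "v $ 3" c]
      dist_nth_less[OF assms(2), of 1] dist_nth_less[OF assms(2), of 2] dist_nth_less[OF assms(2), of 3]
    by auto
  then show ?thesis
    using assms(1) by (cases "even a"; cases "even b"; cases "even c") auto
qed

lemma fundamental_interval: "\<bar>x + 2 * of_int (- \<lfloor>x / 2\<rfloor>)\<bar> \<le> 2" for x :: real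
  by linarith

interpretation HW: free_crystallographic hantzsche_wendt
proof
  show "(\<lambda>v. v) \<in> hantzsche_wendt"
    unfolding hantzsche_wendt_def using hw_0 by force
next
  fix g h assume "g \<in> hantzsche_wendt" "h \<in> hantzsche_wendt"
  then obtain a b c a' b' c' where "g = hw a b c" "even (a + b + c)" "h = hw a' b' c'" "even (a' + b' + c')"
    unfolding hantzsche_wendt_def by blast
  then show "(\<lambda>v. g (h v)) \<in> hantzsche_wendt"
    unfolding hantzsche_wendt_def using even_hw_compose hw_hw by blast
next
  fix g assume "g \<in> hantzsche_wendt"
  then obtain a b c where g: "g = hw a b c" "even (a + b + c)"
    unfolding hantzsche_wendt_def by blast
  then have "even (- (sg c * a) + - (sg a * b) + - (sg b * c))"
    by (auto simp: sg_def)
  then show "\<exists>h\<in>hantzsche_wendt. \<forall>v. h (g v) = v"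
    unfolding hantzsche_wendt_def using g hw_inverse by blast
next
  fix g :: "real^3 \<Rightarrow> real^3" and v assume "g \<in> hantzsche_wendt" "dist v (g v) < 1"
  then show "g = (\<lambda>v. v)"
    unfolding hantzsche_wendt_def using hw_displacement hw_0 by blast
next
  have "\<exists>g\<in>hantzsche_wendt. norm (g v) \<le> 6" for v
  proof -
    \<comment> \<open>Even parameters give pure translations, which bring each of the three
      coordinates to absolute value at most 2; hence the bound 6.\<close>
    let ?g = "hw (2 * - \<lfloor>v $ 1 / 2\<rfloor>) (2 * - \<lfloor>v $ 2 / 2\<rfloor>) (2 * - \<lfloor>v $ 3 / 2\<rfloor>)"
    have "?g v $ i = v $ i + 2 * of_int (- \<lfloor>v $ i / 2\<rfloor>)" for i
      using exhaust_3[of i] by (auto simp: sg_def)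
    then have "\<bar>?g v $ i\<bar> \<le> 2" for i
      by (simp only: fundamental_interval)
    then have "norm (?g v) \<le> 6"
      using norm_le_l1_cart[of "?g v"] sum_bounded_above[of UNIV "\<lambda>i. \<bar>?g v $ i\<bar>" 2] by simp
    moreover have "?g \<in> hantzsche_wendt"
      unfolding hantzsche_wendt_def by fastforce
    ultimately show ?thesis by blast
  qed
  then show "\<exists>R. \<forall>v. \<exists>g\<in>hantzsche_wendt. norm (g v) \<le> R"
    by blast
qed (auto simp: hantzsche_wendt_def affine_map_hw dist_hw)

interpretation torus: free_crystallographic even_shifts
proof
  show "(\<lambda>v. v) \<in> even_shifts"
    by (auto simp: even_shifts_def fun_eq_iff vec_eq_iff forall_2 intro!: exI[of _ 0])
next
  fix g h assume "g \<in> even_shifts" "h \<in> even_shifts"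
  then obtain m n m' n' where "g = even_shift m n" "h = even_shift m' n'"
    unfolding even_shifts_def by blast
  then have "(\<lambda>v. g (h v)) = even_shift (m + m') (n + n')"
    by (auto simp: vec_eq_iff forall_2)
  then show "(\<lambda>v. g (h v)) \<in> even_shifts"
    unfolding even_shifts_def by blast
next
  fix g assume "g \<in> even_shifts"
  then obtain m n where "g = even_shift m n"
    unfolding even_shifts_def by blast
  then have "\<forall>v. even_shift (- m) (- n) (g v) = v"
    by (auto simp: vec_eq_iff forall_2)
  then show "\<exists>h\<in>even_shifts. \<forall>v. h (g v) = v"
    unfolding even_shifts_def by blast
next
  fix g assume "g \<in> even_shifts"
  then obtain m n where g: "g = even_shift m n"
    unfolding even_shifts_def by blast
  then have shift: "g v = v + vector [2 * m, 2 * n]" for v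
    by (auto simp: vec_eq_iff forall_2)
  show "affine_map g"
    by (rule affine_mapI[OF linear_id, of _ "vector [2 * m, 2 * n]"]) (simp add: shift)
  show "dist (g v) (g w) = dist v w" for v w
    by (simp add: shift)
  show "g = (\<lambda>v. v)" if "dist v (g v) < 1" for v
  proof -
    have "m = 0" "n = 0"
      using dist_nth_less[OF that, of 1] dist_nth_less[OF that, of 2] by (auto simp: g)
    then show ?thesis
      by (auto simp: g vec_eq_iff forall_2)
  qed
next
  have "\<exists>g\<in>even_shifts. norm (g v) \<le> 4" for v
  proof -
    let ?g = "even_shift (- \<lfloor>v $ 1 / 2\<rfloor>) (- \<lfloor>v $ 2 / 2\<rfloor>)"
    have "?g v $ i = v $ i + 2 * of_int (- \<lfloor>v $ i / 2\<rfloor>)" for i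
      using exhaust_2[of i] by auto
    then have "\<bar>?g v $ i\<bar> \<le> 2" for i
      by (simp only: fundamental_interval)
    then have "norm (?g v) \<le> 4"
      using norm_le_l1_cart[of "?g v"] sum_bounded_above[of UNIV "\<lambda>i. \<bar>?g v $ i\<bar>" 2] by simp
    moreover have "?g \<in> even_shifts"
      unfolding even_shifts_def by blast
    ultimately show ?thesis by blast
  qed
  then show "\<exists>R. \<forall>v. \<exists>g\<in>even_shifts. norm (g v) \<le> R"
    by blast
qed

text \<open>The offset 1/4 makes the heights of four sheets with different normals add up to an odd
  integer, which excludes quadruple points in \<open>missing_normal\<close>.\<close>

definition plane :: "real^2 \<Rightarrow> real^3" where
  "plane u = vector [u $ 1, u $ 2, 1/4 - u $ 1 - u $ 2]"

text \<open>\<open>snd x\<close> is the representative stored in the torus point \<open>x\<close>;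
  independence of this choice is \<open>plane_immersion_proj\<close>.\<close>

definition plane_immersion :: "nat \<times> (real^2) \<Rightarrow> nat \<times> (real^3)" where
  "plane_immersion x = HW.proj (plane (snd x))"

lemma plane_nth [simp]:
  "plane u $ 1 = u $ 1" "plane u $ 2 = u $ 2" "plane u $ 3 = 1/4 - u $ 1 - u $ 2"
  by (simp_all add: plane_def)

lemma inj_plane: "inj plane"
  by (auto simp: inj_def vec_eq_iff forall_2 forall_3)

lemma affine_map_plane: "affine_map plane"
proof (rule affine_mapI)
  show "linear (\<lambda>u :: real^2. vector [u $ 1, u $ 2, - u $ 1 - u $ 2] :: real^3)"
    by (rule linearI) (simp_all add: vec_eq_iff forall_3 algebra_simps)
  show "plane u = vector [u $ 1, u $ 2, - u $ 1 - u $ 2] + vector [0, 0, 1/4]" for u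
    by (simp add: vec_eq_iff forall_3)
qed

text \<open>The third translation is fixed by the requirement that the sum of the coordinates be
  preserved.\<close>

lemma plane_even_shift: "plane (even_shift m n u) = hw (2 * m) (2 * n) (- 2 * (m + n)) (plane u)"
  by (simp add: vec_eq_iff forall_3 sg_def)

lemma torus_proj_eq_iff: "torus.proj u = torus.proj u' \<longleftrightarrow> (\<exists>m n. u' = even_shift m n u)"
  unfolding torus.proj_eq_iff by (auto simp: even_shifts_def)

lemma HW_proj_eq_iff:
  "HW.proj v = HW.proj w \<longleftrightarrow> (\<exists>a b c. even (a + b + c) \<and> w = hw a b c v)"
  unfolding HW.proj_eq_iff by (auto simp: hantzsche_wendt_def)

lemma plane_immersion_proj: "plane_immersion (torus.proj u) = HW.proj (plane u)"
proof -
  obtain m n where "snd (torus.proj u) = even_shift m n u"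
    using torus_proj_eq_iff torus.proj_snd_proj by metis
  then have "plane (snd (torus.proj u)) = hw (2 * m) (2 * n) (- 2 * (m + n)) (plane u)"
    using plane_even_shift by simp
  moreover have "even (2 * m + 2 * n + - 2 * (m + n))" by simp
  ultimately have "HW.proj (plane u) = HW.proj (plane (snd (torus.proj u)))"
    unfolding HW_proj_eq_iff by blast
  then show ?thesis
    by (simp add: plane_immersion_def)
qed

interpretation cover: affine_covering_map even_shifts hantzsche_wendt plane plane_immersion
  by unfold_locales (simp_all add: affine_map_plane plane_immersion_proj)

section \<open>Double points of the torus and their labels\<close>

lemma sg_eq: "sg k = 1 - 2 * (k mod 2)"
  by (simp add: sg_def parity_cases mod_2_eq_odd)

text \<open>This is freeness: the inverse of one map composed with the other fixes \<open>v\<close>,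
  so \<open>hw_displacement\<close> makes its parameters vanish.\<close>

lemma hw_inj:
  assumes "even (a + b + c)" "even (a' + b' + c')" "hw a b c v = hw a' b' c' v"
  shows "a = a' \<and> b = b' \<and> c = c'"
proof -
  have "hw (- (sg c * a)) (- (sg a * b)) (- (sg b * c)) (hw a' b' c' v) = v"
    using hw_inverse assms(3) by metis
  then have "hw (sg c * (a' - a)) (sg a * (b' - b)) (sg b * (c' - c)) v = v"
    by (simp add: hw_hw sg_uminus_mult) (simp add: algebra_simps)
  moreover have "even (sg c * (a' - a) + sg a * (b' - b) + sg b * (c' - c))"
    using assms(1,2) by (auto simp: sg_def)
  ultimately have "sg c * (a' - a) = 0 \<and> sg a * (b' - b) = 0 \<and> sg b * (c' - c) = 0"
    using hw_displacement by (metis dist_self zero_less_one)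
  then show ?thesis
    by (auto simp: sg_def split: if_splits)
qed

text \<open>With even parameters the map is a translation, and its first two components already form
  an even shift of the torus. Double points thus arise only from elements with nontrivial
  holonomy.\<close>

lemma torus_proj_eqI:
  assumes "hw a b c (plane u) = plane u'" "even a" "even b" "even c"
  shows "torus.proj u = torus.proj u'"
proof -
  obtain m n where "a = 2 * m" "b = 2 * n"
    using assms by (elim evenE) blast
  moreover have "u' $ 1 = u $ 1 + a" "u' $ 2 = u $ 2 + b"
    using assms(2-4) arg_cong[OF assms(1), of "\<lambda>v. v $ 1"] arg_cong[OF assms(1), of "\<lambda>v. v $ 2"]
    by (simp_all add: sg_def)
  ultimately have "u' = even_shift m n u"
    by (simp add: vec_eq_iff forall_2)
  then show ?thesis
    using torus_proj_eq_iff by blast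
qed

text \<open>The double coset of \<open>hw a b c\<close> modulo the translations that preserve the plane.\<close>

definition coset_label :: "int \<Rightarrow> int \<Rightarrow> int \<Rightarrow> int \<times> int \<times> int" where
  "coset_label a b c = (a mod 2, b mod 2, (a + b + c) mod 4)"

text \<open>Other representatives change the group element by plane-preserving translations on both
  sides. By \<open>hw_inj\<close> the parameters can be compared: parities are kept, and the sum
  changes by a multiple of 4.\<close>

lemma coset_label_unique:
  assumes "even (a + b + c)" "hw a b c (plane u) = plane u'"
    and "even (a' + b' + c')" "hw a' b' c' (plane v) = plane v'"
    and "torus.proj u = torus.proj v" "torus.proj u' = torus.proj v'"
  shows "coset_label a b c = coset_label a' b' c'"
proof -
  obtain m n m' n' where "v = even_shift m n u" "v' = even_shift m' n' u'"
    using assms(5,6) torus_proj_eq_iff by metis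
  then have "hw a' b' c' (hw (2 * m) (2 * n) (- 2 * (m + n)) (plane u)) =
      hw (2 * m') (2 * n') (- 2 * (m' + n')) (hw a b c (plane u))"
    using assms plane_even_shift by metis
  then have *: "hw (a' + sg c' * (2 * m)) (b' + sg a' * (2 * n)) (c' + sg b' * (- 2 * (m + n))) (plane u) =
      hw (2 * m' + a) (2 * n' + b) (- 2 * (m' + n') + c) (plane u)"
    unfolding hw_hw by (simp add: sg_def)
  have "a' + sg c' * (2 * m) = 2 * m' + a \<and> b' + sg a' * (2 * n) = 2 * n' + b \<and>
      c' + sg b' * (- 2 * (m + n)) = - 2 * (m' + n') + c"
  proof (rule hw_inj[OF _ _ *])
    show "even (a' + sg c' * (2 * m) + (b' + sg a' * (2 * n)) + (c' + sg b' * (- 2 * (m + n))))"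
      using assms(3) by simp
    show "even (2 * m' + a + (2 * n' + b) + (- 2 * (m' + n') + c))"
      using assms(1) by auto
  qed
  then have eqs: "a' + sg c' * (2 * m) = 2 * m' + a" "b' + sg a' * (2 * n) = 2 * n' + b"
      "c' + sg b' * (- 2 * (m + n)) = - 2 * (m' + n') + c"
    by blast+
  then have "a - a' = 2 * (sg c' * m - m')"
    by (simp add: algebra_simps)
  moreover have "b - b' = 2 * (sg a' * n - n')"
    using eqs by (simp add: algebra_simps)
  ultimately have "a mod 2 = a' mod 2" "b mod 2 = b' mod 2"
    by (simp_all add: mod_eq_dvd_iff)
  moreover have "(a + b + c) - (a' + b' + c') = 2 * (sg c' * m + sg a' * n - sg b' * (m + n))"
    using eqs by (simp add: algebra_simps)
  \<comment> \<open>After \<open>sg k\<close> is replaced by \<open>1 - 2 * (k mod 2)\<close>, the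
    terms \<open>m + n\<close> and \<open>- (m + n)\<close> cancel, and what is left carries a
    second factor 2.\<close>
  then have "(a + b + c) - (a' + b' + c') = 4 * ((b' mod 2) * (m + n) - (c' mod 2) * m - (a' mod 2) * n)"
    unfolding sg_eq by (simp add: algebra_simps)
  then have "(a + b + c) mod 4 = (a' + b' + c') mod 4"
    by (simp add: mod_eq_dvd_iff)
  ultimately show ?thesis
    by (simp only: coset_label_def)
qed

text \<open>The choice is determined by \<open>coset_label_unique\<close> whenever the two points
  have the same image.\<close>

definition label :: "(nat \<times> (real^2)) \<times> (nat \<times> (real^2)) \<Rightarrow> int \<times> int \<times> int" where
  "label p = (SOME l. \<exists>u u' a b c. p = (torus.proj u, torus.proj u') \<and> even (a + b + c) \<and>
     hw a b c (plane u) = plane u' \<and> l = coset_label a b c)"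

lemma label_eq:
  assumes "even (a + b + c)" "hw a b c (plane u) = plane u'"
  shows "label (torus.proj u, torus.proj u') = coset_label a b c"
  unfolding label_def
proof (rule some_equality)
  show "\<exists>v v' i j k. (torus.proj u, torus.proj u') = (torus.proj v, torus.proj v') \<and> even (i + j + k) \<and>
      hw i j k (plane v) = plane v' \<and> coset_label a b c = coset_label i j k"
    using assms by blast
  fix l
  assume "\<exists>v v' i j k. (torus.proj u, torus.proj u') = (torus.proj v, torus.proj v') \<and> even (i + j + k) \<and>
      hw i j k (plane v) = plane v' \<and> l = coset_label i j k"
  then obtain v v' i j k where "torus.proj u = torus.proj v" "torus.proj u' = torus.proj v'"
    "even (i + j + k)" "hw i j k (plane v) = plane v'" "l = coset_label i j k"
    by (elim exE conjE) simp
  then show "l = coset_label a b c"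
    using coset_label_unique[OF assms] by simp
qed

abbreviation torus_conf where
  "torus_conf \<equiv> conf2_top torus.quotient_space plane_immersion"

lemma double_pointE:
  assumes "p \<in> topspace torus_conf"
  obtains u u' a b c where "p = (torus.proj u, torus.proj u')" "even (a + b + c)"
    "hw a b c (plane u) = plane u'" "\<not> (even a \<and> even b \<and> even c)"
proof -
  obtain x x' where "p = (x, x')" "x \<in> range torus.proj" "x' \<in> range torus.proj"
    "x \<noteq> x'" "plane_immersion x = plane_immersion x'"
    using assms unfolding topspace_conf2_top torus.topspace_quotient_space by blast
  then obtain u u' where p: "p = (torus.proj u, torus.proj u')" "torus.proj u \<noteq> torus.proj u'"
    "HW.proj (plane u) = HW.proj (plane u')"
    using plane_immersion_proj by (metis imageE)
  moreover from p(3) obtain a b c where "even (a + b + c)" "hw a b c (plane u) = plane u'"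
    unfolding HW_proj_eq_iff by metis
  ultimately show ?thesis
    using that torus_proj_eqI by blast
qed

text \<open>The element that relates \<open>u\<close> to \<open>u'\<close> also relates nearby
  double points: it carries \<open>plane v\<close> within 1/2 of \<open>plane u'\<close>, and
  \<open>plane v'\<close> is within 1/2 of it as well. Points of one orbit that are less than 1
  apart coincide.\<close>

lemma continuous_map_label: "continuous_map torus_conf (discrete_topology UNIV) label"
proof (rule continuous_map_discreteI)
  fix p assume p: "p \<in> topspace torus_conf"
  then obtain u u' a b c where u: "p = (torus.proj u, torus.proj u')" "even (a + b + c)"
    "hw a b c (plane u) = plane u'"
    using double_pointE by metis
  define near where "near = (\<lambda>w. plane -` ball (plane w) (1/2))"
  have open_near: "open (near w)" "w \<in> near w" for w
    by (auto simp: near_def intro!: open_vimage affine_map_continuous affine_map_plane)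
  define N where "N = (torus.proj ` near u \<times> torus.proj ` near u') \<inter> topspace torus_conf"
  have "openin torus_conf N"
  proof -
    have "openin (prod_topology torus.quotient_space torus.quotient_space)
        (torus.proj ` near u \<times> torus.proj ` near u')"
      using open_near torus.openin_proj_image by (simp add: openin_prod_Times_iff)
    then show ?thesis
      unfolding N_def conf2_top_def by (auto simp: openin_subtopology)
  qed
  moreover have "p \<in> N"
    using p open_near by (auto simp: N_def u)
  moreover have "label q = label p" if q: "q \<in> N" for q
  proof -
    obtain v v' where v: "q = (torus.proj v, torus.proj v')" "v \<in> near u" "v' \<in> near u'"
      using q unfolding N_def by blast
    have "q \<in> topspace torus_conf"
      using q by (simp add: N_def)
    then have "HW.proj (plane v) = HW.proj (plane v')"
      by (simp add: v(1) topspace_conf2_top plane_immersion_proj)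
    then have "HW.proj (hw a b c (plane v)) = HW.proj (plane v')"
      using u(2) HW_proj_eq_iff by metis
    moreover have "dist (hw a b c (plane v)) (plane v') < 1"
    proof -
      have "dist (hw a b c (plane v)) (plane u') = dist (plane v) (plane u)"
        using dist_hw u(3) by metis
      then show ?thesis
        using v(2,3) dist_triangle[of "hw a b c (plane v)" "plane v'" "plane u'"]
        by (simp add: near_def dist_commute)
    qed
    ultimately have "hw a b c (plane v) = plane v'"
      by (rule HW.proj_eq_imp_eq)
    then show ?thesis
      using label_eq u v(1) by metis
  qed
  ultimately show "\<exists>N. openin torus_conf N \<and> p \<in> N \<and> (\<forall>q\<in>N. label q = label p)"
    by blast
qed

text \<open>Exactly two parameters are odd, so
  \<open>(c mod 2) * a + (a mod 2) * b + (b mod 2) * c\<close> is odd and \<open>?r\<close> is even.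
  As the parameter sum is even, inversion exchanges the residues 0 and 2.\<close>

lemma coset_label_inverse:
  assumes "even (a + b + c)" "\<not> (even a \<and> even b \<and> even c)"
  shows "coset_label (- (sg c * a)) (- (sg a * b)) (- (sg b * c)) = (a mod 2, b mod 2, (2 - (a + b + c)) mod 4)"
proof -
  let ?r = "(c mod 2) * a + (a mod 2) * b + (b mod 2) * c - 1"
  have "even ?r"
    using assms by (cases "even a"; cases "even b"; cases "even c") (simp_all add: mod2_eq_if)
  then obtain k where "?r = 2 * k"
    by (elim evenE)
  moreover have "(- (sg c * a) + - (sg a * b) + - (sg b * c)) - (2 - (a + b + c)) = 2 * ?r"
    by (simp add: sg_eq algebra_simps)
  ultimately have "(- (sg c * a) + - (sg a * b) + - (sg b * c)) mod 4 = (2 - (a + b + c)) mod 4"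
    by (simp add: mod_eq_dvd_iff)
  moreover have "- (sg i * j) mod 2 = j mod 2" for i j
    by (simp add: sg_def mod2_eq_if)
  ultimately show ?thesis
    by (simp only: coset_label_def)
qed

lemma label_swap:
  assumes "p \<in> topspace torus_conf"
  shows "label (prod.swap p) = (fst (label p), fst (snd (label p)), (2 - snd (snd (label p))) mod 4)"
    and "even (snd (snd (label p)))"
proof -
  obtain u u' a b c where u: "p = (torus.proj u, torus.proj u')" "even (a + b + c)"
    "hw a b c (plane u) = plane u'" "\<not> (even a \<and> even b \<and> even c)"
    using assms double_pointE by metis
  have label: "label p = (a mod 2, b mod 2, (a + b + c) mod 4)"
    using label_eq[OF u(2,3)] by (simp add: u(1) coset_label_def)
  have "hw (- (sg c * a)) (- (sg a * b)) (- (sg b * c)) (plane u') = plane u"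
    using hw_inverse u(3) by metis
  moreover have "even (- (sg c * a) + - (sg a * b) + - (sg b * c))"
    using u(2) by (auto simp: sg_def)
  ultimately have "label (prod.swap p) = (a mod 2, b mod 2, (2 - (a + b + c)) mod 4)"
    using label_eq[of "- (sg c * a)" "- (sg a * b)" "- (sg b * c)" u' u] coset_label_inverse[OF u(2,4)]
    unfolding u(1) swap_simp by metis
  then show "label (prod.swap p) = (fst (label p), fst (snd (label p)), (2 - snd (snd (label p))) mod 4)"
    by (simp add: label mod_diff_right_eq)
  show "even (snd (snd (label p)))"
    using u(2) unfolding label snd_conv by (intro dvd_mod) simp_all
qed

text \<open>Equal labels mean equal holonomy, and two half-turns about the same axis direction
  compose to a translation. Then the first and third points of the triple coincide by
  \<open>torus_proj_eqI\<close>.\<close>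

lemma label_triple:
  assumes "{x, y, z} \<in> uconf3 torus.quotient_space plane_immersion"
  shows "label (x, y) \<noteq> label (y, z)"
proof
  assume eq: "label (x, y) = label (y, z)"
  have "card {x, y, z} = 3" and xyz: "{x, y, z} \<subseteq> range torus.proj"
    "plane_immersion x = plane_immersion y" "plane_immersion y = plane_immersion z"
    using assms unfolding uconf3_def torus.topspace_quotient_space by blast+
  from this(1) have "x \<noteq> z"
    by (auto simp: card_insert_if split: if_splits)
  obtain u v w where uvw: "x = torus.proj u" "y = torus.proj v" "z = torus.proj w"
    using xyz(1) unfolding insert_subset by (elim conjE imageE)
  then obtain a b c a' b' c' where abc: "even (a + b + c)" "hw a b c (plane u) = plane v"
    "even (a' + b' + c')" "hw a' b' c' (plane v) = plane w"
    using xyz(2,3) HW_proj_eq_iff plane_immersion_proj by metis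
  then have "coset_label a b c = coset_label a' b' c'"
    using eq label_eq uvw by metis
  then have "even a \<longleftrightarrow> even a'" "even b \<longleftrightarrow> even b'"
    unfolding coset_label_def prod.inject by (metis even_mod_2_iff)+
  moreover from this have "even c \<longleftrightarrow> even c'"
    using abc(1,3) by auto
  ultimately have "even (a' + sg c' * a)" "even (b' + sg a' * b)" "even (c' + sg b' * c)"
    by (simp_all add: sg_def)
  moreover have "hw (a' + sg c' * a) (b' + sg a' * b) (c' + sg b' * c) (plane u) = plane w"
    using abc hw_hw by metis
  ultimately have "x = z"
    using torus_proj_eqI uvw by metis
  with \<open>x \<noteq> z\<close> show False ..
qed

section \<open>The two conditions for the torus\<close>

lemma mu2_vanishes_plane_immersion: "mu2_vanishes torus.quotient_space plane_immersion"
proof (rule mu2_vanishesI)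
  \<comment> \<open>The last component of a label is 0 or 2, and swapping the points exchanges these
    values, so testing it for 0 gives the required sign.\<close>
  show "continuous_map torus_conf (discrete_topology UNIV) ((\<lambda>l. snd (snd l) = 0) \<circ> label)"
    by (rule continuous_map_compose[OF continuous_map_label]) simp
  fix p assume p: "p \<in> topspace torus_conf"
  then obtain u u' a b c where "p = (torus.proj u, torus.proj u')" "even (a + b + c)"
    "hw a b c (plane u) = plane u'"
    using double_pointE by metis
  then have "snd (snd (label p)) = (a + b + c) mod 4" "even (a + b + c)"
    using label_eq by (simp_all add: coset_label_def)
  moreover from this(2) obtain k where "a + b + c = 2 * k"
    by (elim evenE)
  then have "(a + b + c) mod 4 = 2 * (k mod 2)"
    using mod_mult_mult1[of 2 k 2] by simp
  ultimately have "snd (snd (label p)) \<in> {0, 2}"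
    by (simp add: mod2_eq_if)
  then show "((\<lambda>l. snd (snd l) = 0) \<circ> label) (prod.swap p) \<longleftrightarrow> \<not> ((\<lambda>l. snd (snd l) = 0) \<circ> label) p"
    using label_swap(1)[OF p] by auto
qed

lemma nu3_vanishes_plane_immersion: "nu3_vanishes torus.quotient_space plane_immersion"
proof (rule nu3_vanishesI)
  show "label (prod.swap p) = label (prod.swap q)"
    if "p \<in> topspace torus_conf" "q \<in> topspace torus_conf" "label p = label q" for p q
    using that by (simp only: label_swap)
qed (fact continuous_map_label label_triple)+

section \<open>General position\<close>

text \<open>The intersection is the orthogonal complement of the span of the normals, whose
  dimension is their number.\<close>

lemma general_position_hyperplanes:
  fixes n :: "'i \<Rightarrow> 'v::euclidean_space"
  assumes "finite I" "inj_on n I" "independent (n ` I)"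
  shows "general_position I (\<lambda>i. {t. n i \<bullet> t = 0})"
proof -
  have "codim {t. n i \<bullet> t = 0} = 1" if "i \<in> I" for i
  proof -
    have "n i \<noteq> 0"
      using assms(3) that dependent_zero by (metis imageI)
    then show ?thesis
      using DIM_positive[where 'a = 'v] by (simp add: codim_def dim_hyperplane)
  qed
  then have "(\<Sum>i\<in>I. codim {t. n i \<bullet> t = 0}) = card I"
    by simp
  moreover have "codim (\<Inter>i\<in>I. {t. n i \<bullet> t = 0}) = card I"
  proof -
    have "(\<Inter>i\<in>I. {t. n i \<bullet> t = 0}) = {t \<in> UNIV. \<forall>x\<in>span (n ` I). orthogonal x t}"
    proof (intro set_eqI iffI)
      fix t assume "t \<in> (\<Inter>i\<in>I. {t. n i \<bullet> t = 0})"
      then have "orthogonal t x" if "x \<in> span (n ` I)" for x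
        using that by (intro orthogonal_to_span[of x "n ` I"]) (auto simp: orthogonal_def inner_commute)
      then show "t \<in> {t \<in> UNIV. \<forall>x\<in>span (n ` I). orthogonal x t}"
        by (auto simp: orthogonal_commute)
    next
      fix t assume "t \<in> {t \<in> UNIV. \<forall>x\<in>span (n ` I). orthogonal x t}"
      then show "t \<in> (\<Inter>i\<in>I. {t. n i \<bullet> t = 0})"
        by (auto simp: orthogonal_def span_base)
    qed
    moreover have "dim {t \<in> UNIV. \<forall>x\<in>span (n ` I). orthogonal x t} + dim (span (n ` I)) = DIM('v)"
      using dim_subspace_orthogonal_to_vectors[of "span (n ` I)" UNIV] by simp
    moreover have "dim (span (n ` I)) = card I"
      using dim_span_eq_card_independent[OF assms(3)] card_image[OF assms(2)] by simp
    ultimately show ?thesis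
      by (simp add: codim_def)
  qed
  ultimately show ?thesis
    using assms(1) by (simp add: general_position_def)
qed

text \<open>Pairing a linear relation on \<open>N\<close> with the missing vertex \<open>k\<close>
  shows that the coefficients sum to 0. Pairing it with \<open>x\<close> then leaves
  \<open>4 * u x = 0\<close>.\<close>

lemma independent_of_tetrahedron:
  fixes N :: "'v::euclidean_space set"
  assumes "finite N" "k \<notin> N"
    and inner: "\<And>x y. x \<in> insert k N \<Longrightarrow> y \<in> insert k N \<Longrightarrow> x \<bullet> y = (if x = y then 3 else - 1)"
  shows "independent N"
  unfolding independent_explicit
proof (intro conjI allI impI ballI)
  fix u x assume sum: "(\<Sum>v\<in>N. u v *\<^sub>R v) = 0" and x: "x \<in> N"
  have dot: "(\<Sum>v\<in>N. u v * (v \<bullet> y)) = 0" for y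
    using arg_cong[OF sum, of "\<lambda>z. z \<bullet> y"] by (simp add: inner_sum_left)
  have "(\<Sum>v\<in>N. u v * (v \<bullet> k)) = (\<Sum>v\<in>N. - u v)"
    using assms(2) inner by (intro sum.cong) auto
  then have "(\<Sum>v\<in>N. u v) = 0"
    using dot[of k] by (simp add: sum_negf)
  have "(\<Sum>v\<in>N. u v * (v \<bullet> x)) = (\<Sum>v\<in>N. (if v = x then 4 * u v else 0) - u v)"
    using x inner by (intro sum.cong) auto
  also have "\<dots> = 4 * u x"
    using assms(1) x \<open>(\<Sum>v\<in>N. u v) = 0\<close> by (simp add: sum_subtractf)
  finally show "u x = 0"
    using dot[of x] by simp
qed (rule assms(1))

text \<open>This is the image of the normal (1, 1, 1) of the plane under the linear part of
  \<open>hw a b c\<close>.\<close>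

definition normal :: "int \<Rightarrow> int \<Rightarrow> int \<Rightarrow> real^3" where
  "normal a b c = vector [sg c, sg a, sg b]"

lemma inner_normal: "normal a b c \<bullet> t = sg c * t $ 1 + sg a * t $ 2 + sg b * t $ 3"
  by (simp add: normal_def inner_vec_def sum_3)

lemma normal_nth [simp]:
  "normal a b c $ 1 = sg c" "normal a b c $ 2 = sg a" "normal a b c $ 3 = sg b"
  by (simp_all add: normal_def)

lemma normal_eq_iff:
  "normal a b c = normal a' b' c' \<longleftrightarrow>
     (even a \<longleftrightarrow> even a') \<and> (even b \<longleftrightarrow> even b') \<and> (even c \<longleftrightarrow> even c')"
  by (auto simp: vec_eq_iff forall_3 sg_def)

text \<open>An even parameter sum leaves the four sign vectors with an even number of minus signs,
  the vertices of a tetrahedron. Two different ones agree in exactly one coordinate.\<close>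

lemma normal_inner_normal:
  assumes "even (a + b + c)" "even (a' + b' + c')"
  shows "normal a b c \<bullet> normal a' b' c' = (if normal a b c = normal a' b' c' then 3 else - 1)"
  using assms unfolding normal_eq_iff inner_normal normal_nth
  by (cases "even a"; cases "even b"; cases "even a'"; cases "even b'") (simp_all add: sg_def)

lemma range_plane_differential:
  "range (\<lambda>u. hw a b c (plane u) - hw a b c (plane 0)) = {t. normal a b c \<bullet> t = 0}"
proof (intro set_eqI iffI)
  fix t assume "t \<in> {t. normal a b c \<bullet> t = 0}"
  then have t: "sg c * t $ 1 + sg a * t $ 2 + sg b * t $ 3 = 0"
    by (simp add: inner_normal)
  let ?u = "vector [sg c * t $ 1, sg a * t $ 2] :: real^2"
  have "hw a b c (plane ?u) - hw a b c (plane 0) = t"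
    using t by (auto simp: vec_eq_iff forall_3 sg_def split: if_splits)
  then show "t \<in> range (\<lambda>u. hw a b c (plane u) - hw a b c (plane 0))"
    by (metis rangeI)
qed (auto simp: inner_normal sg_def)

text \<open>The linear part is orthogonal, so the height is 1/4 plus the pairing of the normal with
  the translation, an integer of the same parity as \<open>a + b + c\<close>.\<close>

lemma normal_inner_plane:
  assumes "even (a + b + c)"
  shows "\<exists>k :: int. normal a b c \<bullet> hw a b c (plane u) = 1/4 + 2 * k"
proof -
  have "normal a b c \<bullet> hw a b c (plane u) = 1/4 + of_int (sg c * a + sg a * b + sg b * c)"
    by (simp add: inner_normal sg_def)
  moreover have "even (sg c * a + sg a * b + sg b * c)"
    using assms by (auto simp: sg_def)
  then obtain k where "sg c * a + sg a * b + sg b * c = 2 * k"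
    by (elim evenE)
  ultimately show ?thesis by auto
qed

text \<open>Four sheets through one point would have the four normals of a tetrahedron, which add up
  to \<open>0\<close>, whereas the heights of the four planes add up to an odd integer.\<close>

lemma missing_normal:
  assumes "\<And>n. n \<in> N \<Longrightarrow> \<exists>a b c u. even (a + b + c) \<and> n = normal a b c \<and> hw a b c (plane u) = q"
  shows "\<exists>a b c. even (a + b + c) \<and> normal a b c \<notin> N"
proof (rule ccontr)
  assume "\<not> ?thesis"
  then have all: "normal a b c \<in> N" if "even (a + b + c)" for a b c
    using that by blast
  have "\<exists>k :: int. normal a b c \<bullet> q = 1/4 + 2 * k" if "even (a + b + c)" for a b c
    using assms[OF all[OF that]] normal_inner_plane by metis
  from this[of 0 0 0] this[of 1 1 0] this[of 0 1 1] this[of 1 0 1]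
  obtain k l m n :: int where "normal 0 0 0 \<bullet> q = 1/4 + 2 * k" "normal 1 1 0 \<bullet> q = 1/4 + 2 * l"
    "normal 0 1 1 \<bullet> q = 1/4 + 2 * m" "normal 1 0 1 \<bullet> q = 1/4 + 2 * n"
    by auto
  then have "real_of_int (1 + 2 * (k + l + m + n)) = 0"
    by (simp add: inner_normal sg_def)
  then have "1 + 2 * (k + l + m + n) = 0"
    by (simp only: of_int_eq_0_iff)
  then show False by presburger
qed

text \<open>Different sheets through \<open>q\<close> have different normals, and at least one of
  the four tetrahedron normals does not occur. The remaining ones are independent.\<close>

lemma generic_plane_immersion:
  "generic_immersion torus.quotient_manifold HW.quotient_manifold plane_immersion"
proof (rule cover.generic_immersionI[OF inj_plane])
  fix q V
  let ?X = "fibre torus.quotient_manifold plane_immersion (HW.proj q)"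
  assume V: "\<And>x. x \<in> ?X \<Longrightarrow> \<exists>u h. torus.proj u = x \<and> h \<in> hantzsche_wendt \<and> h (plane u) = q \<and>
      V x = range (\<lambda>w. h (plane w) - h (plane 0))"
  have "\<exists>u a b c. torus.proj u = x \<and> even (a + b + c) \<and> hw a b c (plane u) = q \<and>
      V x = {t. normal a b c \<bullet> t = 0}" if x: "x \<in> ?X" for x
  proof -
    obtain u h where h: "torus.proj u = x" "h \<in> hantzsche_wendt" "h (plane u) = q"
      "V x = range (\<lambda>w. h (plane w) - h (plane 0))"
      using V[OF x] by blast
    from h(2) obtain a b c where "h = hw a b c" "even (a + b + c)"
      unfolding hantzsche_wendt_def by blast
    then show ?thesis
      using h range_plane_differential by blast
  qed
  then obtain u a b c where u: "\<And>x. x \<in> ?X \<Longrightarrow> torus.proj (u x) = x \<and> even (a x + b x + c x) \<and>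
      hw (a x) (b x) (c x) (plane (u x)) = q \<and> V x = {t. normal (a x) (b x) (c x) \<bullet> t = 0}"
    by metis
  define n where "n = (\<lambda>x. normal (a x) (b x) (c x))"
  have "inj_on n ?X"
  proof (rule inj_onI)
    fix x y assume xy: "x \<in> ?X" "y \<in> ?X" "n x = n y"
    \<comment> \<open>These are the parameters of the element that leads from the sheet of
      \<open>x\<close> to that of \<open>y\<close>. Equal normals make them all even, so the two
      torus points coincide.\<close>
    let ?i = "- (sg (c y) * a y) + sg (c y) * a x" and ?j = "- (sg (a y) * b y) + sg (a y) * b x"
      and ?k = "- (sg (b y) * c y) + sg (b y) * c x"
    have "hw (- (sg (c y) * a y)) (- (sg (a y) * b y)) (- (sg (b y) * c y))
        (hw (a x) (b x) (c x) (plane (u x))) = plane (u y)"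
      using u[OF xy(1)] u[OF xy(2)] hw_inverse by metis
    then have "hw ?i ?j ?k (plane (u x)) = plane (u y)"
      by (simp only: hw_hw sg_uminus_mult)
    moreover have "even ?i" "even ?j" "even ?k"
      using xy(3) by (auto simp: n_def normal_eq_iff sg_def)
    ultimately have "torus.proj (u x) = torus.proj (u y)"
      by (rule torus_proj_eqI)
    then show "x = y"
      using u[OF xy(1)] u[OF xy(2)] by simp
  qed
  obtain i j k where ijk: "even (i + j + k)" "normal i j k \<notin> n ` ?X"
    using missing_normal[of "n ` ?X" q] u unfolding n_def by blast
  have "n ` ?X \<subseteq> (\<lambda>(i, j, k). normal i j k) ` ({0, 1} \<times> {0, 1} \<times> {0, 1})"
  proof (rule image_subsetI)
    fix x
    have mod2: "l mod 2 \<in> {0, 1}" for l :: int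
      unfolding insert_iff empty_iff by presburger
    have "n x = (\<lambda>(i, j, k). normal i j k) (a x mod 2, b x mod 2, c x mod 2)"
      by (simp add: n_def normal_eq_iff)
    then show "n x \<in> (\<lambda>(i, j, k). normal i j k) ` ({0, 1} \<times> {0, 1} \<times> {0, 1})"
      by (rule image_eqI) (intro SigmaI mod2)
  qed
  moreover have "finite ((\<lambda>(i, j, k). normal i j k) ` ({0, 1} \<times> {0, 1} \<times> {0, 1}))"
    by simp
  ultimately have "finite (n ` ?X)"
    by (rule finite_subset)
  moreover have "independent (n ` ?X)"
  proof (rule independent_of_tetrahedron[OF \<open>finite (n ` ?X)\<close> ijk(2)])
    fix v w assume "v \<in> insert (normal i j k) (n ` ?X)" "w \<in> insert (normal i j k) (n ` ?X)"
    then obtain a b c a' b' c' where "v = normal a b c" "even (a + b + c)"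
      "w = normal a' b' c'" "even (a' + b' + c')"
      using u ijk(1) unfolding n_def by blast
    then show "v \<bullet> w = (if v = w then 3 else - 1)"
      using normal_inner_normal by blast
  qed
  ultimately have "general_position ?X (\<lambda>x. {t. n x \<bullet> t = 0})"
    using \<open>inj_on n ?X\<close> finite_imageD by (intro general_position_hyperplanes) auto
  moreover have "V x = {t. n x \<bullet> t = 0}" if "x \<in> ?X" for x
    using u[OF that] by (simp add: n_def)
  ultimately show "general_position ?X V"
    by (simp add: general_position_def)
qed

section \<open>Nonexistence of a lift\<close>

lemma hw_convex_combination:
  "hw a b c ((1 - t) *\<^sub>R v + t *\<^sub>R w) = (1 - t) *\<^sub>R hw a b c v + t *\<^sub>R hw a b c w"
  by (simp add: vec_eq_iff forall_3 algebra_simps)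

lemma plane_convex_combination:
  "plane ((1 - t) *\<^sub>R v + t *\<^sub>R w) = (1 - t) *\<^sub>R plane v + t *\<^sub>R plane w"
  by (simp add: vec_eq_iff forall_3 algebra_simps)

text \<open>The segments from \<open>u\<close> to \<open>v\<close> and from \<open>u'\<close> to
  \<open>v'\<close> are matched by the affine map. A change of order would give a zero of the height
  difference on the way.\<close>

lemma order_constant_on_double_line:
  fixes H :: "real^2 \<Rightarrow> real"
  assumes H: "continuous_on UNIV H"
    and ne: "\<And>w w'. hw a b c (plane w) = plane w' \<Longrightarrow> H w \<noteq> H w'"
    and "hw a b c (plane u) = plane u'" "hw a b c (plane v) = plane v'" "H u < H u'"
  shows "H v < H v'"
proof (rule ccontr)
  assume not: "\<not> H v < H v'"
  let ?g = "\<lambda>t. H ((1 - t) *\<^sub>R u' + t *\<^sub>R v') - H ((1 - t) *\<^sub>R u + t *\<^sub>R v)"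
  have "continuous_on {0..1} ?g"
    by (intro continuous_intros continuous_on_compose2[OF H]) auto
  moreover have "?g 1 \<le> 0" "0 \<le> ?g 0"
    using not assms(5) by auto
  ultimately obtain t where "?g t = 0"
    using IVT2'[of ?g 1 0 0] by auto
  moreover have "hw a b c (plane ((1 - t) *\<^sub>R u + t *\<^sub>R v)) = plane ((1 - t) *\<^sub>R u' + t *\<^sub>R v')"
    using assms(3,4) by (simp only: plane_convex_combination hw_convex_combination)
  ultimately show False
    using ne by force
qed

text \<open>A converse to \<open>coset_label_unique\<close> for nontrivial holonomy: even shifts of
  \<open>u\<close> and \<open>u'\<close> turn the parameters \<open>a, b, c\<close> into
  \<open>a', b', c'\<close>, provided that the third coordinates match.\<close>

lemma coset_label_representative:
  assumes "hw a b c (plane u) = plane u'" "\<not> (even a \<and> even b \<and> even c)"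
    and "even (a + b + c)" "even (a' + b' + c')" "coset_label a b c = coset_label a' b' c'"
  obtains v v' where "hw a' b' c' (plane v) = plane v'" "torus.proj v = torus.proj u"
    "torus.proj v' = torus.proj u'"
proof -
  have mods: "a mod 2 = a' mod 2" "b mod 2 = b' mod 2" "(a + b + c) mod 4 = (a' + b' + c') mod 4"
    using assms(5) by (simp_all add: coset_label_def)
  have "even a \<longleftrightarrow> even a'" "even b \<longleftrightarrow> even b'"
    using mods by (metis even_mod_2_iff)+
  moreover from this have "even c \<longleftrightarrow> even c'"
    using assms(3,4) by auto
  ultimately have sg: "sg a' = sg a" "sg b' = sg b" "sg c' = sg c"
    and "c mod 2 = c' mod 2"
    by (simp_all add: sg_def mod2_eq_if)
  have "2 dvd a' - a" "2 dvd b' - b" "2 dvd c' - c" "4 dvd (a' + b' + c') - (a + b + c)"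
    using mods \<open>c mod 2 = c' mod 2\<close> by (simp_all only: mod_eq_dvd_iff[symmetric])
  then obtain d1 d2 d3 k where d: "a' - a = 2 * d1" "b' - b = 2 * d2" "c' - c = 2 * d3"
    and "(a' + b' + c') - (a + b + c) = 4 * k"
    by (elim dvdE)
  then have k: "d1 + d2 + d3 = 2 * k"
    by linarith
  \<comment> \<open>The coefficients of \<open>m\<close> and \<open>n\<close> are
    \<open>sg b - sg c\<close> and \<open>sg b - sg a\<close>. For a half-turn one of them is 2 or
    -2, and a multiple of that variable alone suffices.\<close>
  have "\<exists>m n. sg b * (m + n) - sg c * m - sg a * n = 2 * k"
  proof (cases "even c")
    case True
    then have "sg b * (- k + 0) - sg c * - k - sg a * 0 = 2 * k"
      using assms(2,3) by (auto simp: sg_def)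
    then show ?thesis by blast
  next
    case odd: False
    show ?thesis
    proof (cases "even a")
      case True
      then have "sg b * (0 + - k) - sg c * 0 - sg a * - k = 2 * k"
        using odd assms(3) by (auto simp: sg_def)
      then show ?thesis by blast
    next
      case False
      then have "sg b * (k + 0) - sg c * k - sg a * 0 = 2 * k"
        using odd assms(3) by (auto simp: sg_def)
      then show ?thesis by blast
    qed
  qed
  then obtain m n where "sg b * (m + n) - sg c * m - sg a * n = d1 + d2 + d3"
    using k by metis
  then have "- (sg b * (m + n)) + d3 = - (sg c * m + d1) - (sg a * n + d2)"
    by simp
  from arg_cong[OF this, of real_of_int]
  have third: "- (real_of_int (sg b) * (m + n)) + d3 = - (sg c * m + d1) - (sg a * n + d2)"
    by simp
  have abc': "a' = a + 2 * d1" "b' = b + 2 * d2" "c' = c + 2 * d3"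
    using d by simp_all
  have "hw a' b' c' (plane (even_shift m n u)) = plane (even_shift (sg c * m + d1) (sg a * n + d2) u')"
  proof -
    have "hw a b c (plane u) $ i = plane u' $ i" for i
      using assms(1) by simp
    from this[of 1] this[of 2] this[of 3] third show ?thesis
      unfolding vec_eq_iff forall_3 hw_nth plane_nth even_shift_nth sg
      by (simp add: abc' algebra_simps)
  qed
  moreover have "torus.proj (even_shift i j w) = torus.proj w" for i j w
    using torus_proj_eq_iff by metis
  ultimately show ?thesis
    using that by blast
qed

lemma hw_hw_inverse: "hw a b c (hw (- (sg c * a)) (- (sg a * b)) (- (sg b * c)) v) = v"
  by (simp add: vec_eq_iff forall_3 sg_uminus_mult) (simp add: sg_def)

lemma triple_point:
  assumes "s \<in> {1, - 1}" "r \<in> {1, - 1}"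
  obtains u u' u'' where "hw 1 s 0 (plane u) = plane u'" "hw 0 1 r (plane u') = plane u''"
    "hw (- 1) (1 + s) r (plane u) = plane u''"
proof
  \<comment> \<open>Let \<open>x\<close> be the first coordinate of \<open>?u\<close> and
    \<open>y\<close> the second of \<open>?u'\<close>. The two images lie in the plane exactly when
    \<open>2 * x + 1 + s = 1/2\<close> and \<open>2 * y + 1 + r = 1/2\<close>.\<close>
  let ?u = "vector [1/4 - (1 + s) / 2, - 1/4 + (1 + s) / 2 + (s + r) / 2] :: real^2"
  let ?u' = "vector [?u $ 1 + 1, - ?u $ 2 + s] :: real^2"
  let ?u'' = "vector [- ?u' $ 1, ?u' $ 2 + 1] :: real^2"
  show "hw 1 s 0 (plane ?u) = plane ?u'" "hw 0 1 r (plane ?u') = plane ?u''"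
    "hw (- 1) (1 + s) r (plane ?u) = plane ?u''"
    using assms by (auto simp: vec_eq_iff forall_3 sg_def)
qed

lemma no_lift: "\<not> lifts_to_embedding torus.quotient_space HW.quotient_space plane_immersion"
proof
  assume "lifts_to_embedding torus.quotient_space HW.quotient_space plane_immersion"
  then obtain F where F: "embedding_map torus.quotient_space (prod_topology HW.quotient_space euclideanreal) F"
    and fst_F: "\<And>u. fst (F (torus.proj u)) = plane_immersion (torus.proj u)"
    unfolding lifts_to_embedding_def by auto
  \<comment> \<open>The height of the supposed lift, pulled back to the universal cover of the
    torus.\<close>
  define H where "H = (\<lambda>u. snd (F (torus.proj u)))"
  have H_cong: "H u = H v" if "torus.proj u = torus.proj v" for u v
    using that by (simp add: H_def)
  have "continuous_map torus.quotient_space (prod_topology HW.quotient_space euclideanreal) F"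
    using homeomorphic_imp_continuous_map[OF F[unfolded embedding_map_def]]
    by (simp add: continuous_map_in_subtopology)
  then have "continuous_map euclidean euclideanreal (snd \<circ> (F \<circ> torus.proj))"
    using torus.continuous_map_proj continuous_map_compose continuous_map_snd by metis
  then have H: "continuous_on UNIV H"
    by (simp add: H_def o_def)
  have inj_F: "inj_on F (range torus.proj)"
    using homeomorphic_imp_injective_map[OF F[unfolded embedding_map_def]] by simp
  have ne: "H u \<noteq> H u'"
    if "hw a b c (plane u) = plane u'" "even (a + b + c)" "\<not> (even a \<and> even b \<and> even c)" for a b c u u'
  proof
    assume "H u = H u'"
    moreover have "plane_immersion (torus.proj u) = plane_immersion (torus.proj u')"
      unfolding plane_immersion_proj HW_proj_eq_iff using that by metis
    ultimately have "F (torus.proj u) = F (torus.proj u')"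
      using fst_F by (simp add: H_def prod_eq_iff)
    then have "torus.proj u = torus.proj u'"
      using inj_F by (simp add: inj_on_def)
    \<comment> \<open>If the torus points coincided, the identity would join the same pair, so
      uniqueness of the label would make \<open>a\<close>, \<open>b\<close> and \<open>c\<close>
      even.\<close>
    then have "coset_label a b c = coset_label 0 0 0"
      using that by (intro coset_label_unique[of _ _ _ u u' _ _ _ u u]) (simp_all add: hw_0)
    then show False
      using that by (auto simp: coset_label_def mod_eq_0_iff_dvd)
  qed
  define up where "up = (\<lambda>a b c. \<forall>u u'. hw a b c (plane u) = plane u' \<longrightarrow> H u < H u')"
  define down where "down = (\<lambda>a b c. \<forall>u u'. hw a b c (plane u) = plane u' \<longrightarrow> H u' < H u)"
  have up_or_down: "up a b c \<or> down a b c"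
    if abc: "even (a + b + c)" "\<not> (even a \<and> even b \<and> even c)" for a b c
  proof (rule disjCI)
    assume "\<not> down a b c"
    then obtain u u' where u: "hw a b c (plane u) = plane u'" "\<not> H u' < H u"
      by (auto simp: down_def)
    then have "H u < H u'"
      using ne[OF u(1) abc] by simp
    then show "up a b c"
      unfolding up_def using order_constant_on_double_line[OF H ne[OF _ abc] u(1)] by blast
  qed
  have up_cong: "up a' b' c'"
    if abc: "up a b c" "even (a + b + c)" "even (a' + b' + c')" "\<not> (even a' \<and> even b' \<and> even c')"
      "coset_label a' b' c' = coset_label a b c" for a b c a' b' c'
    unfolding up_def
  proof (intro allI impI)
    fix v v' assume v: "hw a' b' c' (plane v) = plane v'"
    obtain w w' where w: "hw a b c (plane w) = plane w'" "torus.proj w = torus.proj v"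
      "torus.proj w' = torus.proj v'"
      by (rule coset_label_representative[OF v abc(4,3,2,5)])
    have "H w < H w'"
      using abc(1) w(1) by (simp add: up_def)
    then show "H v < H v'"
      using H_cong[OF w(2)] H_cong[OF w(3)] by simp
  qed
  have up_inverse: "up (- (sg c * a)) (- (sg a * b)) (- (sg b * c))" if "down a b c" for a b c
    unfolding up_def
  proof (intro allI impI)
    fix v v' assume "hw (- (sg c * a)) (- (sg a * b)) (- (sg b * c)) (plane v) = plane v'"
    then have "hw a b c (plane v') = plane v"
      using hw_hw_inverse by metis
    then show "H v < H v'"
      using that by (simp add: down_def)
  qed
  have down_inverse: "down a b c" if "up (- (sg c * a)) (- (sg a * b)) (- (sg b * c))" for a b c
    unfolding down_def
  proof (intro allI impI)
    fix v v' assume "hw a b c (plane v) = plane v'"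
    then have "hw (- (sg c * a)) (- (sg a * b)) (- (sg b * c)) (plane v') = plane v"
      using hw_inverse by metis
    then show "H v' < H v"
      using that by (simp add: up_def)
  qed
  \<comment> \<open>The inverse of \<open>hw 1 (- 1) 0\<close> has the label of
    \<open>hw 1 1 0\<close>, so these two elements order their sheets oppositely; \<open>s\<close>
    records which of them goes up. The same argument for the second holonomy yields
    \<open>r\<close>.\<close>
  have "\<exists>s\<in>{1, - 1}. up 1 s 0 \<and> down 1 (- s) 0"
    using up_or_down[of 1 1 0]
  proof
    assume up: "up 1 1 0"
    have "up (- 1) (- 1) 0"
      by (rule up_cong[OF up]) (simp_all add: coset_label_def)
    then have "down 1 (- 1) 0"
      using down_inverse[of 0 1 "- 1"] by (simp add: sg_def)
    then show ?thesis using up by auto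
  next
    assume down: "down 1 1 0"
    then have "up (- 1) 1 0"
      using up_inverse[of 1 1 0] by (simp add: sg_def)
    then have "up 1 (- 1) 0"
      by (rule up_cong) (simp_all add: coset_label_def)
    then show ?thesis using down by auto
  qed simp_all
  moreover have "\<exists>s\<in>{1, - 1}. up 0 1 s \<and> down 0 1 (- s)"
    using up_or_down[of 0 1 1]
  proof
    assume up: "up 0 1 1"
    have "up 0 (- 1) (- 1)"
      by (rule up_cong[OF up]) (simp_all add: coset_label_def)
    then have "down 0 1 (- 1)"
      using down_inverse[of "- 1" 0 1] by (simp add: sg_def)
    then show ?thesis using up by auto
  next
    assume down: "down 0 1 1"
    then have "up 0 (- 1) 1"
      using up_inverse[of 0 1 1] by (simp add: sg_def)
    then have "up 0 1 (- 1)"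
      by (rule up_cong) (simp_all add: coset_label_def)
    then show ?thesis using down by auto
  qed simp_all
  ultimately obtain s r where s: "s \<in> {1, - 1}" "up 1 s 0" "down 1 (- s) 0"
    and r: "r \<in> {1, - 1}" "up 0 1 r" "down 0 1 (- r)"
    by blast
  \<comment> \<open>Two upward steps at this triple point force their composite, which has the third
    holonomy, to go up.\<close>
  obtain u u' u'' where u: "hw 1 s 0 (plane u) = plane u'" "hw 0 1 r (plane u') = plane u''"
    "hw (- 1) (1 + s) r (plane u) = plane u''"
    using triple_point[OF s(1) r(1)] .
  moreover have "H u < H u''"
    using u s(2) r(2) by (force simp: up_def)
  ultimately have "\<not> down (- 1) (1 + s) r"
    unfolding down_def by (metis less_asym)
  then have "up (- 1) (1 + s) r"
    using up_or_down[of "- 1" "1 + s" r] s(1) r(1) by auto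
  \<comment> \<open>The parameter sums \<open>s + r\<close> and \<open>- s - r\<close> differ by
    twice an even number, and the parities agree, so the labels are equal.\<close>
  then have "up (- 1) (1 - s) (- r)"
    by (rule up_cong) (use s(1) r(1) in \<open>auto simp: coset_label_def\<close>)
  \<comment> \<open>At the triple point with both signs reversed the two steps go down while their
    composite goes up, a contradiction.\<close>
  obtain v v' v'' where v: "hw 1 (- s) 0 (plane v) = plane v'" "hw 0 1 (- r) (plane v') = plane v''"
    "hw (- 1) (1 - s) (- r) (plane v) = plane v''"
    using triple_point[of "- s" "- r"] s(1) r(1) by auto
  then have "H v < H v''"
    using \<open>up (- 1) (1 - s) (- r)\<close> by (simp add: up_def)
  moreover have "H v'' < H v"
    using v s(3) r(3) by (force simp: down_def)
  ultimately show False by simp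
qed

theorem theorem5:
  shows "\<exists>(T :: (nat \<times> (real^2), 2) manifold) (Y :: (nat \<times> (real^3), 3) manifold) j.
           smooth_manifold T \<and> compact_space (space_of T) \<and>
           smooth_manifold Y \<and> compact_space (space_of Y) \<and>
           generic_immersion T Y j \<and>
           mu2_vanishes (space_of T) j \<and> nu3_vanishes (space_of T) j \<and>
           \<not> lifts_to_embedding (space_of T) (space_of Y) j"
  using torus.smooth_manifold_quotient_manifold torus.compact_quotient_space
    HW.smooth_manifold_quotient_manifold HW.compact_quotient_space generic_plane_immersion
    mu2_vanishes_plane_immersion nu3_vanishes_plane_immersion no_lift
  by (intro exI[of _ torus.quotient_manifold] exI[of _ HW.quotient_manifold] exI[of _ plane_immersion]) simp

end
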